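(* Let $\boldsymbol{A} \in \mathbb{C}^{N\times N}$ be a nonzero positive-semidefinite (psd) matrix. Fix $r \in \mathbb{N}$ (with $r \ge 1$) and a real number $\varepsilon > 0$. Let $\widehat{\boldsymbol{A}}^{(k)}$ be the rank-$k$ column Nyström approximation produced by $k$ steps of the randomly pivoted Cholesky algorithm applied to $\boldsymbol{A}$. Then $$\mathbb{E} \operatorname{tr}\bigl(\boldsymbol{A} - \widehat{\boldsymbol{A}}^{(k)}\bigr) \le (1+\varepsilon)\cdot \operatorname{tr}\bigl(\boldsymbol{A} - \llbracket \boldsymbol{A} \rrbracket_r\bigr),$$ provided that the number $k$ of columns satisfies $$k \ge \frac{r}{\varepsilon} + \min\left\{ r \log\left(\frac{1}{\varepsilon\eta}\right),\; r + r\log_+\left(\frac{2^r}{\varepsilon}\right)\right\}.$$ Here the relative error is $\eta := \operatorname{tr}(\boldsymbol{A} - \llbracket \boldsymbol{A} \rrbracket_r)/\operatorname{tr}(\boldsymbol{A})$.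
   Context: Matrices are complex and psd matrices are Hermitian. $\boldsymbol{M}(i,j)$ denotes the $(i,j)$ entry, $\boldsymbol{M}(:,j)$ the $j$th column and $\boldsymbol{M}(j,:)$ the $j$th row. $\llbracket \boldsymbol{A} \rrbracket_r$ denotes a best rank-$r$ approximation of a psd matrix $\boldsymbol{A}$, obtained by truncating an eigendecomposition to the $r$ largest eigenvalues, so $\operatorname{tr}(\boldsymbol{A} - \llbracket \boldsymbol{A} \rrbracket_r) = \sum_{i>r} \lambda_i(\boldsymbol{A})$ with $\lambda_1(\boldsymbol{A})\ge\lambda_2(\boldsymbol{A})\ge\cdots$ the eigenvalues. $\log$ is the natural logarithm, and $\log_+(x) := \max\{\log x, 0\}$ for $x>0$. If $\eta=0$, then $\log(1/(\varepsilon\eta))$ is interpreted as $+\infty$. The number of steps $k$ is a nonnegative integer. Randomly pivoted Cholesky algorithm: initialize $\widehat{\boldsymbol{A}}^{(0)} = \boldsymbol{0}$ and the residual $\boldsymbol{A}^{(0)} = \boldsymbol{A}$. At each step $i=1,2,\dots,k$, conditionally on the past, draw a random pivot $s_i \in \{1,\dots,N\}$ with $$\mathbb{P}\{s_i = j\} = \frac{\boldsymbol{A}^{(i-1)}(j,j)}{\operatorname{tr}\boldsymbol{A}^{(i-1)}}, \quad j=1,\dots,N,$$ and set $$\widehat{\boldsymbol{A}}^{(i)} = \widehat{\boldsymbol{A}}^{(i-1)} + \frac{\boldsymbol{A}^{(i-1)}(:,s_i)\boldsymbol{A}^{(i-1)}(s_i,:)}{\boldsymbol{A}^{(i-1)}(s_i,s_i)},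 \qquad \boldsymbol{A}^{(i)} = \boldsymbol{A}^{(i-1)} - \frac{\boldsymbol{A}^{(i-1)}(:,s_i)\boldsymbol{A}^{(i-1)}(s_i,:)}{\boldsymbol{A}^{(i-1)}(s_i,s_i)}.$$ If $\boldsymbol{A}^{(i-1)} = \boldsymbol{0}$, the matrices are left unchanged from then on. Thus $\boldsymbol{A}^{(k)} = \boldsymbol{A} - \widehat{\boldsymbol{A}}^{(k)}$, and $\widehat{\boldsymbol{A}}^{(k)} = \boldsymbol{A}(:,\mathsf{S})\boldsymbol{A}(\mathsf{S},\mathsf{S})^{\dagger}\boldsymbol{A}(\mathsf{S},:)$ is the column Nyström approximation for the pivot set $\mathsf{S}=\{s_1,\dots,s_k\}$ ($\dagger$ is the Moore–Penrose pseudoinverse). The expectation is over the random pivots. *)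

theory Defs
  imports "HOL-Probability.Probability_Mass_Function" "Jordan_Normal_Form.Schur_Decomposition"
begin

section \<open>Positive-semidefinite matrices\<close>

definition mat_trace :: "'a :: comm_monoid_add mat \<Rightarrow> 'a" where
  "mat_trace A = (\<Sum>i<dim_row A. A $$ (i, i))"

definition psd_mat :: "nat \<Rightarrow> complex mat \<Rightarrow> bool" where
  "psd_mat N A \<longleftrightarrow> A \<in> carrier_mat N N \<and> mat_adjoint A = A \<and>
     (\<forall>v\<in>carrier_vec N. 0 \<le> Re ((A *\<^sub>v v) \<bullet>c v))"


section \<open>Best rank-$r$ approximation\<close>

text \<open>The eigenvalues \<open>ev 0 \<ge> ev 1 \<ge> \<dots>\<close> are listed with multiplicity and indexed from 0.\<close>

definition eigendecomposition ::
    "nat \<Rightarrow> complex mat \<Rightarrow> complex mat \<Rightarrow> (nat \<Rightarrow> real) \<Rightarrow> bool" where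
  "eigendecomposition N A U ev \<longleftrightarrow>
     U \<in> carrier_mat N N \<and> mat_adjoint U * U = 1\<^sub>m N \<and>
     (\<forall>i j. i \<le> j \<longrightarrow> j < N \<longrightarrow> ev j \<le> ev i) \<and>
     A = U * mat_diag N (\<lambda>i. complex_of_real (ev i)) * mat_adjoint U"

text \<open>The truncation depends on the eigendecomposition when the \<open>r\<close>-th and the next eigenvalue
  coincide, hence the choice operator; its trace does not. For \<open>r \<ge> N\<close> nothing is
  cut off.\<close>

definition best_rank_approx :: "nat \<Rightarrow> complex mat \<Rightarrow> complex mat" where
  "best_rank_approx r A = (SOME B. \<exists>U ev. eigendecomposition (dim_row A) A U ev \<and>
     B = U * mat_diag (dim_row A) (\<lambda>i. if i < r then complex_of_real (ev i) else 0)
           * mat_adjoint U)"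

definition rel_error :: "nat \<Rightarrow> complex mat \<Rightarrow> real" where
  "rel_error r A = Re (mat_trace (A - best_rank_approx r A)) / Re (mat_trace A)"


section \<open>Randomly pivoted Cholesky\<close>

text \<open>Pivots are indexed from 0. \<open>embed_pmf\<close> is meaningful because the weights are
  nonnegative and sum to 1 for nonzero psd matrices; see \<open>pmf_pivot\<close> below. All residuals of a psd
  matrix are psd, being Schur complements.\<close>

definition pivot_pmf :: "complex mat \<Rightarrow> nat pmf" where
  "pivot_pmf R = embed_pmf (\<lambda>j. if j < dim_row R then Re (R $$ (j, j)) / Re (mat_trace R) else 0)"

definition pivot_update :: "complex mat \<Rightarrow> nat \<Rightarrow> complex mat" where
  "pivot_update R s = Matrix.mat (dim_row R) (dim_col R)
     (\<lambda>(i, j). R $$ (i, s) * R $$ (s, j) / R $$ (s, s))"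

text \<open>The joint law of the approximation and the residual after the given number of steps.\<close>

primrec rp_cholesky :: "complex mat \<Rightarrow> nat \<Rightarrow> (complex mat \<times> complex mat) pmf" where
  "rp_cholesky A 0 = return_pmf (0\<^sub>m (dim_row A) (dim_col A), A)"
| "rp_cholesky A (Suc i) = bind_pmf (rp_cholesky A i) (\<lambda>(Ahat, R).
     if R = 0\<^sub>m (dim_row A) (dim_col A) then return_pmf (Ahat, R)
     else map_pmf (\<lambda>s. (Ahat + pivot_update R s, R - pivot_update R s)) (pivot_pmf R))"


section \<open>Logarithms\<close>

definition log_plus :: "real \<Rightarrow> real" where
  "log_plus x = max (ln x) 0"

text \<open>This is applied to \<open>\<epsilon> * \<eta>\<close> with \<open>\<epsilon> > 0\<close>, which vanishes exactly when
  \<open>\<eta> = 0\<close>.\<close>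

definition log_recip :: "real \<Rightarrow> ereal" where
  "log_recip x = (if x = 0 then \<infinity> else ereal (ln (1 / x)))"


section \<open>The pivot distribution is well defined\<close>

lemma mat_adjoint_index:
  assumes "A \<in> carrier_mat n m" "i < m" "j < n"
  shows "mat_adjoint A $$ (i, j) = conjugate (A $$ (j, i))"
  using assms unfolding mat_adjoint_def by (auto simp: mat_of_rows_def)

lemma psd_mat_sym:
  assumes "psd_mat N A" "i < N" "j < N"
  shows "A $$ (j, i) = cnj (A $$ (i, j))"
  using assms mat_adjoint_index[of A N N j i] by (auto simp: psd_mat_def)

lemma quad_form_expand:
  assumes A: "A \<in> carrier_mat N N" and v: "v \<in> carrier_vec N"
  shows "(A *\<^sub>v v) \<bullet>c v =
    (\<Sum>i<N. \<Sum>j<N. A $$ (i, j) * vec_index v j * cnj (vec_index v i))"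
proof -
  have "(A *\<^sub>v v) \<bullet>c v = (\<Sum>i<N. vec_index (A *\<^sub>v v) i * cnj (vec_index v i))"
    using v by (simp add: scalar_prod_def atLeast0LessThan)
  also have "\<dots> = (\<Sum>i<N. (\<Sum>j<N. A $$ (i, j) * vec_index v j) * cnj (vec_index v i))"
    using A v by (intro sum.cong) (auto simp: scalar_prod_def atLeast0LessThan)
  finally show ?thesis by (simp add: sum_distrib_right)
qed

lemma quad_form_pair:
  fixes a b :: complex
  assumes A: "A \<in> carrier_mat N N" and ij: "i < N" "j < N" "i \<noteq> j"
  defines "v \<equiv> Matrix.vec N (\<lambda>l. if l = i then a else if l = j then b else 0)"
  shows "(A *\<^sub>v v) \<bullet>c v = A $$ (i, i) * a * cnj a + A $$ (i, j) * b * cnj a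
    + A $$ (j, i) * a * cnj b + A $$ (j, j) * b * cnj b"
proof -
  have v: "v \<in> carrier_vec N" by (simp add: v_def)
  have two: "(\<Sum>l<N. f l) = f i + f j" if "\<And>l. l \<noteq> i \<Longrightarrow> l \<noteq> j \<Longrightarrow> f l = 0"
    for f :: "nat \<Rightarrow> complex"
  proof -
    have "(\<Sum>l<N. f l) = (\<Sum>l\<in>{i, j}. f l)"
      by (rule sum.mono_neutral_right) (use ij that in auto)
    then show ?thesis using ij by simp
  qed
  have "(A *\<^sub>v v) \<bullet>c v =
      (\<Sum>p<N. \<Sum>q<N. A $$ (p, q) * (if q = i then a else if q = j then b else 0)
        * cnj (if p = i then a else if p = j then b else 0))"
    unfolding quad_form_expand[OF A v] by (intro sum.cong refl) (auto simp: v_def)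
  also have "\<dots> = A $$ (i, i) * a * cnj a + A $$ (i, j) * b * cnj a
    + A $$ (j, i) * a * cnj b + A $$ (j, j) * b * cnj b"
    using ij by (subst two; simp add: two)
  finally show ?thesis .
qed

lemma psd_mat_diag_nonneg:
  assumes A: "psd_mat N A" and i: "i < N"
  shows "0 \<le> Re (A $$ (i, i))"
proof -
  have car: "A \<in> carrier_mat N N" using A by (simp add: psd_mat_def)
  have "0 \<le> Re ((A *\<^sub>v unit_vec N i) \<bullet>c unit_vec N i)"
    using A by (simp add: psd_mat_def)
  also have "(A *\<^sub>v unit_vec N i) \<bullet>c unit_vec N i =
     (\<Sum>p<N. \<Sum>q<N. if q = i then if p = i then A $$ (p, q) else 0 else 0)"
    unfolding quad_form_expand[OF car unit_vec_carrier] using i by (intro sum.cong) auto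
  also have "\<dots> = A $$ (i, i)"
    using i by simp
  finally show ?thesis .
qed

lemma psd_mat_trace_pos:
  assumes A: "psd_mat N A" and nz: "A \<noteq> 0\<^sub>m N N"
  shows "0 < Re (mat_trace A)"
proof (rule ccontr)
  assume neg: "\<not> 0 < Re (mat_trace A)"
  have car: "A \<in> carrier_mat N N" using A by (simp add: psd_mat_def)
  then have tr: "Re (mat_trace A) = (\<Sum>i<N. Re (A $$ (i, i)))" by (simp add: mat_trace_def)
  have nn: "0 \<le> Re (A $$ (i, i))" if "i < N" for i using psd_mat_diag_nonneg[OF A that] .
  have "(\<Sum>i<N. Re (A $$ (i, i))) = 0"
    using neg tr nn by (intro antisym sum_nonneg) auto
  then have diag: "Re (A $$ (i, i)) = 0" if "i < N" for i
    using nn that by (subst (asm) sum_nonneg_eq_0_iff) auto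
  have "A $$ (i, j) = 0" if ij: "i < N" "j < N" for i j
  proof (cases "i = j")
    case True
    have "Im (A $$ (i, i)) = 0"
      using psd_mat_sym[OF A ij(1) ij(1)] by (metis complex_is_Real_iff Reals_cnj_iff)
    then show ?thesis using diag[OF ij(1)] True by (simp add: complex_eq_iff)
  next
    case False
    define v where "v = Matrix.vec N (\<lambda>l. if l = i then 1 else if l = j then - cnj (A $$ (i, j)) else 0)"
    have cm: "(cmod z)\<^sup>2 = Re z * Re z + Im z * Im z" for z
      unfolding cmod_power2 by (simp add: power2_eq_square)
    have "0 \<le> Re ((A *\<^sub>v v) \<bullet>c v)"
      using A by (simp add: psd_mat_def v_def)
    also have "Re ((A *\<^sub>v v) \<bullet>c v) = - 2 * (cmod (A $$ (i, j)))\<^sup>2"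
      unfolding v_def quad_form_pair[OF car ij False] psd_mat_sym[OF A ij]
      using diag[OF ij(1)] diag[OF ij(2)]
      by (simp add: cm algebra_simps)
    finally show ?thesis by simp
  qed
  then have "A = 0\<^sub>m N N" using car by (intro eq_matI) auto
  then show False using nz by simp
qed

lemma pmf_pivot:
  assumes A: "psd_mat N A" and nz: "A \<noteq> 0\<^sub>m N N"
  shows "pmf (pivot_pmf A) j = (if j < N then Re (A $$ (j, j)) / Re (mat_trace A) else 0)"
proof -
  have car: "A \<in> carrier_mat N N" using A by (simp add: psd_mat_def)
  have pos: "0 < Re (mat_trace A)" by (rule psd_mat_trace_pos[OF A nz])
  define f where "f = (\<lambda>j. if j < N then Re (A $$ (j, j)) / Re (mat_trace A) else 0)"
  have nn: "0 \<le> f j" for j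
    using psd_mat_diag_nonneg[OF A] pos by (auto simp: f_def)
  have "(\<integral>\<^sup>+ x. ennreal (f x) \<partial>count_space UNIV) = (\<Sum>x<N. ennreal (f x))"
    by (rule nn_integral_count_space') (auto simp: f_def)
  also have "\<dots> = ennreal (\<Sum>x<N. f x)"
    using nn by (rule sum_ennreal)
  also have "(\<Sum>x<N. f x) = 1"
    using pos car by (simp add: f_def sum_divide_distrib[symmetric] mat_trace_def)
  finally have "pmf (embed_pmf f) j = f j"
    using nn by (intro pmf_embed_pmf) auto
  then show ?thesis using car by (simp add: pivot_pmf_def f_def)
qed

end

theory Submission
  imports Defs
begin

text \<open>
  Let \<open>P\<close> be the spectral projector onto the top \<open>r\<close> eigenvectors of \<open>A\<close>, let
  \<open>b = tr ((1 - P) A)\<close>, and let \<open>x\<^sub>i\<close> be the expectation of \<open>tr (P R)\<close> for the residual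
  \<open>R\<close> after \<open>i\<close> steps. Residuals only decrease, so the expected error is at most \<open>x\<^sub>k + b\<close>.
  A pivot step lowers \<open>tr (P R)\<close> on average by \<open>tr (P R\<^sup>2) / tr R\<close>, which by Cauchy--Schwarz
  is at least \<open>(tr (P R))\<^sup>2 / (r tr R)\<close>; as \<open>a\<^sup>2 / (a + b)\<close> is convex in \<open>a\<close>, this gives
  \<open>x\<^sub>i\<^sub>+\<^sub>1 \<le> x\<^sub>i - x\<^sub>i\<^sup>2 / (r (x\<^sub>i + b))\<close>. The potential \<open>r ln x - r b / x\<close>
  therefore drops by 1 in each step, and starting from \<open>x\<^sub>0 \<le> tr A\<close> yields the first bound
  on \<open>k\<close>.

  For the second bound, the expected optimal rank-\<open>(m-1)\<close> error after a step is at most twice the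
  optimal rank-\<open>m\<close> error before it: if the pivot is \<open>s\<close>, remove the direction \<open>P e\<^sub>s\<close> from the
  range of the spectral projector \<open>P\<close> of rank \<open>m\<close>. Hence \<open>x\<^sub>r \<le> 2\<^sup>r b\<close>, and the recursion is
  started there instead.
\<close>

section \<open>Adjoints, traces and positive-semidefinite matrices\<close>

lemma adjoint_carrier [simp, intro]:
  "A \<in> carrier_mat n m \<Longrightarrow> mat_adjoint A \<in> carrier_mat m n"
  unfolding mat_adjoint_def by (auto simp: mat_of_rows_def)

lemma adjoint_dim [simp]: "dim_row (mat_adjoint A) = dim_col A" "dim_col (mat_adjoint A) = dim_row A"
  unfolding mat_adjoint_def by (auto simp: mat_of_rows_def)

lemma adjoint_index [simp]:
  fixes A :: "complex mat"
  shows "i < dim_col A \<Longrightarrow> j < dim_row A \<Longrightarrow> mat_adjoint A $$ (i, j) = cnj (A $$ (j, i))"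
  using mat_adjoint_index[of A "dim_row A" "dim_col A" i j] by auto

lemma mult_index_sum:
  assumes "A \<in> carrier_mat n m" "B \<in> carrier_mat m p" "i < n" "j < p"
  shows "(A * B) $$ (i, j) = (\<Sum>l<m. A $$ (i, l) * B $$ (l, j))"
  using assms by (auto simp: scalar_prod_def atLeast0LessThan intro!: sum.cong)

lemma adjoint_adjoint [simp]: "mat_adjoint (mat_adjoint A) = (A :: complex mat)"
  by (rule eq_matI) auto

lemma adjoint_mult:
  fixes A B :: "complex mat"
  assumes A: "A \<in> carrier_mat n m" and B: "B \<in> carrier_mat m p"
  shows "mat_adjoint (A * B) = mat_adjoint B * mat_adjoint A"
proof (rule eq_matI)
  fix i j assume "i < dim_row (mat_adjoint B * mat_adjoint A)" "j < dim_col (mat_adjoint B * mat_adjoint A)"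
  then have ij: "i < p" "j < n" using A B by auto
  have "mat_adjoint (A * B) $$ (i, j) = cnj ((A * B) $$ (j, i))"
    using A B ij by (intro adjoint_index) auto
  then show "mat_adjoint (A * B) $$ (i, j) = (mat_adjoint B * mat_adjoint A) $$ (i, j)"
    using A B ij unfolding mult_index_sum[OF A B ij(2,1)]
      mult_index_sum[OF adjoint_carrier[OF B] adjoint_carrier[OF A] ij]
    by (auto intro!: sum.cong)
qed (use A B in auto)

lemma adjoint_minus:
  fixes A B :: "complex mat"
  assumes "A \<in> carrier_mat n m" "B \<in> carrier_mat n m"
  shows "mat_adjoint (A - B) = mat_adjoint A - mat_adjoint B"
  using assms by (intro eq_matI) auto

lemma trace_carrier: "A \<in> carrier_mat n n \<Longrightarrow> mat_trace A = (\<Sum>i<n. A $$ (i, i))"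
  by (simp add: mat_trace_def)

lemma trace_mult:
  assumes "A \<in> carrier_mat n m" "B \<in> carrier_mat m n"
  shows "mat_trace (A * B) = (\<Sum>i<n. \<Sum>j<m. A $$ (i, j) * B $$ (j, i))"
proof -
  have "A * B \<in> carrier_mat n n" using assms by auto
  from trace_carrier[OF this] show ?thesis by (simp add: mult_index_sum[OF assms])
qed

lemma trace_comm:
  fixes A B :: "'a :: comm_semiring_0 mat"
  assumes "A \<in> carrier_mat n m" "B \<in> carrier_mat m n"
  shows "mat_trace (A * B) = mat_trace (B * A)"
  unfolding trace_mult[OF assms] trace_mult[OF assms(2,1)]
  by (subst sum.swap) (simp add: mult.commute)

lemma trace_minus:
  fixes A B :: "'a :: ab_group_add mat"
  assumes "A \<in> carrier_mat n n" "B \<in> carrier_mat n n"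
  shows "mat_trace (A - B) = mat_trace A - mat_trace B"
  using assms by (simp add: mat_trace_def sum_subtractf)

section \<open>Quadratic forms and closure properties of psd matrices\<close>

lemma psd_carrier: "psd_mat n R \<Longrightarrow> R \<in> carrier_mat n n"
  by (simp add: psd_mat_def)

lemma psd_herm: "psd_mat n R \<Longrightarrow> mat_adjoint R = R"
  by (simp add: psd_mat_def)

lemma cscalar_prod_sum:
  fixes v w :: "complex vec"
  shows "v \<in> carrier_vec n \<Longrightarrow> w \<in> carrier_vec n \<Longrightarrow> v \<bullet>c w = (\<Sum>i<n. v $ i * cnj (w $ i))"
  by (simp add: scalar_prod_def atLeast0LessThan)

lemma mult_mat_vec_index:
  assumes "A \<in> carrier_mat n m" "v \<in> carrier_vec m" "i < n"
  shows "(A *\<^sub>v v) $ i = (\<Sum>l<m. A $$ (i, l) * v $ l)"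
  using assms by (auto simp: scalar_prod_def atLeast0LessThan intro!: sum.cong)

lemma adjoint_cscalar_prod:
  fixes X :: "complex mat"
  assumes X: "X \<in> carrier_mat n m" and v: "v \<in> carrier_vec n" and w: "w \<in> carrier_vec m"
  shows "(mat_adjoint X *\<^sub>v v) \<bullet>c w = v \<bullet>c (X *\<^sub>v w)"
proof -
  have Xv: "mat_adjoint X *\<^sub>v v \<in> carrier_vec m" using X v by (auto intro: mult_mat_vec_carrier)
  have Xw: "X *\<^sub>v w \<in> carrier_vec n" using X w by auto
  have "(mat_adjoint X *\<^sub>v v) \<bullet>c w = (\<Sum>i<m. \<Sum>l<n. cnj (X $$ (l, i)) * v $ l * cnj (w $ i))"
    unfolding cscalar_prod_sum[OF Xv w] using X
    by (auto simp: mult_mat_vec_index[OF adjoint_carrier[OF X] v] sum_distrib_right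
        simp del: index_mult_mat_vec intro!: sum.cong)
  also have "\<dots> = (\<Sum>l<n. \<Sum>i<m. cnj (X $$ (l, i)) * v $ l * cnj (w $ i))"
    by (rule sum.swap)
  also have "\<dots> = v \<bullet>c (X *\<^sub>v w)"
    unfolding cscalar_prod_sum[OF v Xw]
    by (auto simp: mult_mat_vec_index[OF X w] sum_distrib_left mult_ac simp del: index_mult_mat_vec intro!: sum.cong)
  finally show ?thesis .
qed

text \<open>Moving \<open>X\<close> across the inner product turns the form at \<open>v\<close> into
  the form of \<open>R\<close> at \<open>X *\<^sub>v v\<close>. Pivot updates, residuals and
  projectors are all shown to be psd by exhibiting them as such congruences.\<close>

lemma psd_congruence:
  assumes R: "psd_mat n R" and X: "X \<in> carrier_mat n m"
  shows "psd_mat m (mat_adjoint X * R * X)"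
proof -
  note Rc = psd_carrier[OF R]
  note X' = adjoint_carrier[OF X]
  have "mat_adjoint (mat_adjoint X * R * X) = mat_adjoint X * R * X"
    unfolding adjoint_mult[OF mult_carrier_mat[OF X' Rc] X] adjoint_mult[OF X' Rc]
    using psd_herm[OF R] assoc_mult_mat[OF X' Rc X] by simp
  moreover have "0 \<le> Re ((mat_adjoint X * R * X *\<^sub>v v) \<bullet>c v)" if v: "v \<in> carrier_vec m" for v
  proof -
    have "mat_adjoint X * R * X *\<^sub>v v = mat_adjoint X *\<^sub>v (R *\<^sub>v (X *\<^sub>v v))"
      unfolding assoc_mult_mat_vec[OF mult_carrier_mat[OF X' Rc] X v]
      by (rule assoc_mult_mat_vec[OF X' Rc mult_mat_vec_carrier[OF X v]])
    then have "(mat_adjoint X * R * X *\<^sub>v v) \<bullet>c v = (R *\<^sub>v (X *\<^sub>v v)) \<bullet>c (X *\<^sub>v v)"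
      using Rc X v by (simp add: adjoint_cscalar_prod[OF X])
    then show ?thesis using R X v unfolding psd_mat_def by auto
  qed
  moreover have "mat_adjoint X * R * X \<in> carrier_mat m m"
    by (rule mult_carrier_mat[OF mult_carrier_mat[OF X' Rc] X])
  ultimately show ?thesis unfolding psd_mat_def by blast
qed

lemma psd_add:
  assumes A: "psd_mat n A" and B: "psd_mat n B"
  shows "psd_mat n (A + B)"
proof -
  note c = psd_carrier[OF A] psd_carrier[OF B]
  have "mat_adjoint (A + B) = A + B"
  proof (rule eq_matI)
    fix i j assume "i < dim_row (A + B)" "j < dim_col (A + B)"
    then show "mat_adjoint (A + B) $$ (i, j) = (A + B) $$ (i, j)"
      using c psd_mat_sym[OF A, of j i] psd_mat_sym[OF B, of j i] by auto
  qed (use c in auto)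
  moreover have "((A + B) *\<^sub>v v) \<bullet>c v = (A *\<^sub>v v) \<bullet>c v + (B *\<^sub>v v) \<bullet>c v"
    if "v \<in> carrier_vec n" for v
    using c that by (simp add: add_mult_distrib_mat_vec[of _ n n] add_scalar_prod_distrib[of _ n])
  ultimately show ?thesis using A B unfolding psd_mat_def by auto
qed

lemma psd_zero: "psd_mat n (0\<^sub>m n n)"
proof -
  have "mat_adjoint (0\<^sub>m n n :: complex mat) = 0\<^sub>m n n" by (rule eq_matI) auto
  then show ?thesis using psd_mat_def quad_form_expand[of "0\<^sub>m n n" n] by simp
qed

lemma psd_trace_nonneg: "psd_mat n R \<Longrightarrow> 0 \<le> Re (mat_trace R)"
  using psd_mat_diag_nonneg[of n R] psd_carrier[of n R] by (auto simp: trace_carrier intro!: sum_nonneg)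

lemma psd_diag_real: "psd_mat n R \<Longrightarrow> i < n \<Longrightarrow> R $$ (i, i) = complex_of_real (Re (R $$ (i, i)))"
  by (metis psd_mat_sym Reals_cnj_iff of_real_Re)

text \<open>A nonzero entry beside a zero diagonal entry would make the quadratic form affine and
  decreasing along a suitable ray, hence eventually negative. This is what makes division by a zero
  pivot harmless later on.\<close>

lemma psd_diag_zero:
  assumes R: "psd_mat n R" and ij: "i < n" "s < n" and z: "R $$ (s, s) = 0"
  shows "R $$ (i, s) = 0"
proof (rule ccontr)
  assume nz: "R $$ (i, s) \<noteq> 0"
  then have ne: "i \<noteq> s" using z by auto
  define d where "d = (cmod (R $$ (i, s)))\<^sup>2"
  have d: "d > 0" using nz by (simp add: d_def)
  \<comment> \<open>Chosen so that the form at the test vector \<open>v\<close>, which is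
    \<open>Re (R $$ (i, i)) - 2 * c * d\<close>, equals -1.\<close>
  define c where "c = (Re (R $$ (i, i)) + 1) / (2 * d)"
  define v where "v = Matrix.vec n (\<lambda>l. if l = i then 1 else if l = s then - of_real c * cnj (R $$ (i, s)) else 0)"
  have cm: "(cmod z)\<^sup>2 = Re z * Re z + Im z * Im z" for z
    unfolding cmod_power2 by (simp add: power2_eq_square)
  have "0 \<le> Re ((R *\<^sub>v v) \<bullet>c v)"
    using R by (simp add: psd_mat_def v_def)
  also have "Re ((R *\<^sub>v v) \<bullet>c v) = Re (R $$ (i, i)) - 2 * c * d"
    unfolding v_def quad_form_pair[OF psd_carrier[OF R] ij ne] psd_mat_sym[OF R ij] d_def cm
    using z by (simp add: algebra_simps)
  also have "\<dots> = - 1" using d by (simp add: c_def field_simps)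
  finally show False by simp
qed

section \<open>Orthogonal projectors\<close>

text \<open>The rank is bounded through the trace and need not be attained, so that \<open>m > n\<close> is
  allowed.\<close>

definition orth_proj :: "nat \<Rightarrow> nat \<Rightarrow> complex mat \<Rightarrow> bool" where
  "orth_proj n m P \<longleftrightarrow> P \<in> carrier_mat n n \<and> mat_adjoint P = P \<and> P * P = P \<and>
     Re (mat_trace P) \<le> real m"

lemma orth_projD:
  assumes "orth_proj n m P"
  shows "P \<in> carrier_mat n n" "mat_adjoint P = P" "P * P = P" "Re (mat_trace P) \<le> real m"
  using assms by (auto simp: orth_proj_def)

lemma psd_one: "psd_mat n (1\<^sub>m n)"
proof -
  have "Re (v \<bullet>c v) \<ge> 0" if "v \<in> carrier_vec n" for v :: "complex vec"
    unfolding cscalar_prod_sum[OF that that] Re_sum by (intro sum_nonneg) simp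
  then show ?thesis by (auto simp: psd_mat_def)
qed

lemma orth_proj_psd:
  assumes P: "orth_proj n m P"
  shows "psd_mat n P"
  using psd_congruence[OF psd_one, of P n n] orth_projD[OF P] by simp

text \<open>The rank bound is the crude \<open>n\<close>, since the complement only serves in
  positivity and monotonicity arguments.\<close>

lemma orth_proj_compl:
  assumes P: "orth_proj n m P"
  shows "orth_proj n n (1\<^sub>m n - P)"
proof -
  note d = orth_projD[OF P]
  have tr: "mat_trace (1\<^sub>m n - P) = of_nat n - mat_trace P"
    using d by (subst trace_minus[of _ n]) (auto simp: mat_trace_def)
  have "(1\<^sub>m n - P) * (1\<^sub>m n - P) = 1\<^sub>m n - P"
    using d(1,3) minus_mult_distrib_mat[OF one_carrier_mat d(1) minus_carrier_mat[OF d(1)]]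
      mult_minus_distrib_mat[OF d(1) one_carrier_mat d(1)] by (auto simp: minus_r_inv_mat[of _ n n])
  moreover have "0 \<le> Re (mat_trace P)" by (rule psd_trace_nonneg[OF orth_proj_psd[OF P]])
  ultimately show ?thesis
    unfolding orth_proj_def using d tr by (auto simp: adjoint_minus[of _ n n])
qed

text \<open>Cyclicity of the trace and idempotence. The product \<open>P * R\<close> need not be
  Hermitian, whereas \<open>P * R * P\<close> is a congruence of \<open>R\<close>.\<close>

lemma orth_proj_trace_sandwich:
  assumes P: "orth_proj n m P" and R: "R \<in> carrier_mat n n"
  shows "mat_trace (P * R * P) = mat_trace (P * R)"
proof -
  note d = orth_projD[OF P]
  have "mat_trace (P * R * P) = mat_trace (P * (P * R))"
    using d R by (intro trace_comm[of _ n n]) auto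
  also have "P * (P * R) = P * R" using d R by (simp flip: assoc_mult_mat[of _ n n _ n _ n])
  finally show ?thesis .
qed

lemma orth_proj_trace_nonneg:
  assumes P: "orth_proj n m P" and R: "psd_mat n R"
  shows "0 \<le> Re (mat_trace (P * R))"
  using psd_trace_nonneg[OF psd_congruence[OF R, of P n]] orth_projD[OF P]
    orth_proj_trace_sandwich[OF P psd_carrier[OF R]] by simp

lemma trace_split:
  fixes P R :: "complex mat"
  assumes P: "P \<in> carrier_mat n n" and R: "R \<in> carrier_mat n n"
  shows "mat_trace ((1\<^sub>m n - P) * R) = mat_trace R - mat_trace (P * R)"
  using assms trace_minus[OF R, of "P * R"] by (simp add: minus_mult_distrib_mat[OF one_carrier_mat P R])

lemma orth_proj_trace_mono:
  assumes P: "orth_proj n m P" and A: "A \<in> carrier_mat n n" "B \<in> carrier_mat n n"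
    and AB: "psd_mat n (A - B)"
  shows "Re (mat_trace (P * B)) \<le> Re (mat_trace (P * A))"
  using orth_proj_trace_nonneg[OF P AB] orth_projD(1)[OF P] A
  by (simp add: mult_minus_distrib_mat[of _ n n] trace_minus[of _ n])

lemma orth_proj_trace_le:
  assumes P: "orth_proj n m P" and R: "psd_mat n R"
  shows "Re (mat_trace (P * R)) \<le> Re (mat_trace R)"
  using orth_proj_trace_nonneg[OF orth_proj_compl[OF P] R] orth_projD(1)[OF P] psd_carrier[OF R]
  by (simp add: trace_split)

section \<open>Cauchy--Schwarz for the Frobenius inner product\<close>

lemma trace_adjoint_mult:
  fixes X Y :: "complex mat"
  assumes X: "X \<in> carrier_mat n m" and Y: "Y \<in> carrier_mat n m"
  shows "mat_trace (mat_adjoint X * Y) = (\<Sum>p\<in>{..<m} \<times> {..<n}. cnj (X $$ (snd p, fst p)) * Y $$ (snd p, fst p))"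
  using X Y unfolding trace_mult[OF adjoint_carrier[OF X] Y] sum.cartesian_product
  by (auto intro!: sum.cong)

lemma trace_Cauchy_Schwarz:
  fixes X Y :: "complex mat"
  assumes X: "X \<in> carrier_mat n m" and Y: "Y \<in> carrier_mat n m"
  shows "(Re (mat_trace (mat_adjoint X * Y)))\<^sup>2
    \<le> Re (mat_trace (mat_adjoint X * X)) * Re (mat_trace (mat_adjoint Y * Y))"
proof -
  define S where "S = {..<m} \<times> {..<n}"
  define x where "x p = cmod (X $$ (snd p, fst p))" for p
  define y where "y p = cmod (Y $$ (snd p, fst p))" for p
  have sq: "Re (mat_trace (mat_adjoint Z * Z)) = (\<Sum>p\<in>S. (cmod (Z $$ (snd p, fst p)))\<^sup>2)"
    if "Z \<in> carrier_mat n m" for Z :: "complex mat"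
    unfolding trace_adjoint_mult[OF that that] S_def Re_sum
    by (intro sum.cong refl) (simp only: cmod_power2, simp add: power2_eq_square)
  have "\<bar>Re (mat_trace (mat_adjoint X * Y))\<bar> \<le> cmod (mat_trace (mat_adjoint X * Y))"
    by (rule abs_Re_le_cmod)
  also have "\<dots> \<le> (\<Sum>p\<in>S. x p * y p)"
    unfolding trace_adjoint_mult[OF X Y] S_def[symmetric] x_def y_def
    by (rule order.trans[OF norm_sum]) (simp add: norm_mult)
  finally have "(Re (mat_trace (mat_adjoint X * Y)))\<^sup>2 \<le> (\<Sum>p\<in>S. x p * y p)\<^sup>2"
    using power_mono[OF _ abs_ge_zero, of _ _ 2] by fastforce
  also have "\<dots> \<le> (\<Sum>p\<in>S. (x p)\<^sup>2) * (\<Sum>p\<in>S. (y p)\<^sup>2)"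
    by (rule Cauchy_Schwarz_ineq_sum)
  finally show ?thesis by (simp add: sq X Y x_def y_def)
qed

text \<open>Cauchy--Schwarz for the pair \<open>P\<close> and \<open>R * P\<close>: their inner
  product is \<open>mat_trace (P * R)\<close>, and their squared norms are the two factors on the
  right. The rank of the projector enters the analysis of a pivot step through
  \<open>mat_trace P\<close>.\<close>

lemma orth_proj_trace_square:
  assumes P: "orth_proj n m P" and R: "psd_mat n R"
  shows "(Re (mat_trace (P * R)))\<^sup>2 \<le> Re (mat_trace P) * Re (mat_trace (P * (R * R)))"
proof -
  note d = orth_projD[OF P] and Rc = psd_carrier[OF R]
  have RP: "R * P \<in> carrier_mat n n" using d Rc by auto
  have "mat_adjoint (R * P) * (R * P) = P * (R * R) * P"
    using d Rc psd_herm[OF R] by (simp add: adjoint_mult[of _ n n _ n] assoc_mult_mat[of _ n n _ n _ n])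
  moreover have "mat_trace (mat_adjoint P * (R * P)) = mat_trace (P * R)"
    using d Rc orth_proj_trace_sandwich[OF P Rc] by (simp add: assoc_mult_mat[of _ n n _ n _ n])
  ultimately show ?thesis
    using trace_Cauchy_Schwarz[OF d(1) RP] d Rc
    by (simp add: orth_proj_trace_sandwich[OF P, of "R * R"])
qed

section \<open>One pivoting step\<close>

lemma pivot_update_index:
  assumes "R \<in> carrier_mat n n" "i < n" "j < n"
  shows "pivot_update R s $$ (i, j) = R $$ (i, s) * R $$ (s, j) / R $$ (s, s)"
  using assms by (simp add: pivot_update_def)

lemma pivot_update_carrier [simp, intro]:
  "R \<in> carrier_mat n n \<Longrightarrow> pivot_update R s \<in> carrier_mat n n"
  by (auto simp: pivot_update_def)

lemma pivot_update_dim [simp]: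
  "dim_row (pivot_update R s) = dim_row R" "dim_col (pivot_update R s) = dim_col R"
  by (simp_all add: pivot_update_def)

text \<open>Division by zero gives 0, so a zero pivot changes nothing and sums may run over all
  pivots without side conditions.\<close>

lemma pivot_update_zero:
  assumes R: "R \<in> carrier_mat n n" and z: "R $$ (s, s) = 0"
  shows "pivot_update R s = 0\<^sub>m n n"
  using assms by (intro eq_matI) (auto simp: pivot_update_index)

text \<open>For a nonzero pivot, the update is the congruence of \<open>R\<close> by the matrix
  \<open>X\<close> whose only nonzero row is row \<open>s\<close> of \<open>R\<close> divided by the
  pivot.\<close>

lemma psd_pivot_update:
  assumes R: "psd_mat n R" and s: "s < n"
  shows "psd_mat n (pivot_update R s)"
proof (cases "R $$ (s, s) = 0")
  case True
  then show ?thesis using R psd_zero by (simp add: pivot_update_zero[OF psd_carrier[OF R]])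
next
  case nz: False
  note Rc = psd_carrier[OF R]
  define X where "X = Matrix.mat n n (\<lambda>(i, j). if i = s then R $$ (s, j) / R $$ (s, s) else 0)"
  have X: "X \<in> carrier_mat n n" by (simp add: X_def)
  have Xe: "X $$ (i, j) = (if i = s then R $$ (s, j) / R $$ (s, s) else 0)" if "i < n" "j < n" for i j
    using that by (simp add: X_def)
  have RX: "(R * X) $$ (l, j) = R $$ (l, s) * R $$ (s, j) / R $$ (s, s)" if "l < n" "j < n" for l j
    using that s by (simp add: mult_index_sum[OF Rc X] Xe if_distrib sum.delta del: index_mult_mat cong: if_cong)
  have "mat_adjoint X * (R * X) = pivot_update R s"
  proof (rule eq_matI)
    fix i j assume "i < dim_row (pivot_update R s)" "j < dim_col (pivot_update R s)"
    then have ij: "i < n" "j < n" using Rc by (auto simp: pivot_update_def)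
    have "(mat_adjoint X * (R * X)) $$ (i, j) = (\<Sum>l<n. mat_adjoint X $$ (i, l) * (R * X) $$ (l, j))"
      using X Rc ij by (intro mult_index_sum) auto
    also have "\<dots> = (\<Sum>l<n. if l = s then cnj (R $$ (s, i) / R $$ (s, s)) * (R $$ (s, s) * R $$ (s, j) / R $$ (s, s)) else 0)"
      using ij X by (intro sum.cong) (auto simp: RX Xe simp del: index_mult_mat)
    also have "\<dots> = pivot_update R s $$ (i, j)"
      using s ij nz psd_mat_sym[OF R s ij(1)] psd_mat_sym[OF R s s, symmetric]
      by (simp add: pivot_update_index[OF Rc])
    finally show "(mat_adjoint X * (R * X)) $$ (i, j) = pivot_update R s $$ (i, j)" .
  qed (use X Rc in \<open>auto simp: pivot_update_def\<close>)
  then show ?thesis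
    using psd_congruence[OF R X] X Rc assoc_mult_mat[OF adjoint_carrier[OF X] Rc X] by simp
qed

text \<open>The Schur complement is the congruence of \<open>R\<close> by the elimination matrix,
  the identity minus the rank-one matrix used for the update.\<close>

lemma psd_pivot_residual:
  assumes R: "psd_mat n R" and s: "s < n"
  shows "psd_mat n (R - pivot_update R s)"
proof (cases "R $$ (s, s) = 0")
  case True
  have "R - 0\<^sub>m n n = R" using psd_carrier[OF R] by auto
  then show ?thesis using R True by (simp add: pivot_update_zero[OF psd_carrier[OF R]])
next
  case nz: False
  note Rc = psd_carrier[OF R]
  define X where "X = Matrix.mat n n (\<lambda>(i, j). (if i = j then 1 else 0) - (if i = s then R $$ (s, j) / R $$ (s, s) else 0))"
  have X: "X \<in> carrier_mat n n" by (simp add: X_def)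
  have Xe: "X $$ (i, j) = (if i = j then 1 else 0) - (if i = s then R $$ (s, j) / R $$ (s, s) else 0)"
    if "i < n" "j < n" for i j
    using that by (simp add: X_def)
  have RX: "(R * X) $$ (l, j) = R $$ (l, j) - R $$ (l, s) * R $$ (s, j) / R $$ (s, s)" if "l < n" "j < n" for l j
    using that s by (simp add: mult_index_sum[OF Rc X] Xe right_diff_distrib sum_subtractf
        if_distrib[of "(*) _"] sum.delta del: index_mult_mat cong: if_cong)
  have "mat_adjoint X * (R * X) = R - pivot_update R s"
  proof (rule eq_matI)
    fix i j assume "i < dim_row (R - pivot_update R s)" "j < dim_col (R - pivot_update R s)"
    then have ij: "i < n" "j < n" using Rc by (auto simp: pivot_update_def)
    have "(mat_adjoint X * (R * X)) $$ (i, j) = (\<Sum>l<n. mat_adjoint X $$ (i, l) * (R * X) $$ (l, j))"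
      using X Rc ij by (intro mult_index_sum) auto
    \<comment> \<open>Row \<open>s\<close> of \<open>R * X\<close> vanishes, so of
      \<open>mat_adjoint X\<close> only the identity part contributes.\<close>
    also have "\<dots> = (\<Sum>l<n. if l = i then (R * X) $$ (i, j) else 0)"
      using ij X s nz by (intro sum.cong) (auto simp: RX Xe simp del: index_mult_mat)
    also have "\<dots> = (R - pivot_update R s) $$ (i, j)"
      using s ij Rc
      by (auto simp: pivot_update_index[OF Rc] RX simp del: index_mult_mat)
    finally show "(mat_adjoint X * (R * X)) $$ (i, j) = (R - pivot_update R s) $$ (i, j)" .
  qed (use X Rc in \<open>auto simp: pivot_update_def\<close>)
  then show ?thesis
    using psd_congruence[OF R X] X Rc assoc_mult_mat[OF adjoint_carrier[OF X] Rc X] by simp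
qed

lemma pivot_residual_trace_le:
  assumes P: "orth_proj n m P" and R: "psd_mat n R" and s: "s < n"
  shows "Re (mat_trace (P * (R - pivot_update R s))) \<le> Re (mat_trace (P * R))"
proof -
  note Rc = psd_carrier[OF R]
  have "R - (R - pivot_update R s) = pivot_update R s"
    using Rc by (intro eq_matI) (auto simp: pivot_update_index)
  then show ?thesis
    using psd_pivot_update[OF R s] Rc pivot_update_carrier[OF Rc, of s]
    by (intro orth_proj_trace_mono[OF P]) (auto intro: minus_carrier_mat)
qed

text \<open>\<open>R $$ (s, s)\<close> times the update is column \<open>s\<close> of
  \<open>R\<close> times row \<open>s\<close>, also for a zero pivot because its row and column then
  vanish. Summing these outer products over \<open>s\<close> gives \<open>R * R\<close>.\<close>

lemma weighted_pivot_trace: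
  assumes R: "psd_mat n R" and Q: "Q \<in> carrier_mat n n"
  shows "(\<Sum>s<n. R $$ (s, s) * mat_trace (Q * pivot_update R s)) = mat_trace (Q * (R * R))"
proof -
  note Rc = psd_carrier[OF R]
  have pu: "R $$ (s, s) * pivot_update R s $$ (i, j) = R $$ (i, s) * R $$ (s, j)"
    if "s < n" "i < n" "j < n" for s i j
    using psd_diag_zero[OF R] that by (cases "R $$ (s, s) = 0") (auto simp: pivot_update_index[OF Rc])
  have "(\<Sum>s<n. R $$ (s, s) * mat_trace (Q * pivot_update R s))
      = (\<Sum>s<n. \<Sum>i<n. \<Sum>j<n. Q $$ (i, j) * (R $$ (s, s) * pivot_update R s $$ (j, i)))"
    by (intro sum.cong refl, subst trace_mult[OF Q pivot_update_carrier[OF Rc]])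
      (simp add: sum_distrib_left mult_ac)
  also have "\<dots> = (\<Sum>s<n. \<Sum>i<n. \<Sum>j<n. Q $$ (i, j) * (R $$ (j, s) * R $$ (s, i)))"
    by (intro sum.cong refl) (simp add: pu)
  also have "\<dots> = (\<Sum>i<n. \<Sum>s<n. \<Sum>j<n. Q $$ (i, j) * (R $$ (j, s) * R $$ (s, i)))"
    by (rule sum.swap)
  also have "\<dots> = (\<Sum>i<n. \<Sum>j<n. \<Sum>s<n. Q $$ (i, j) * (R $$ (j, s) * R $$ (s, i)))"
    by (rule sum.cong[OF refl]) (rule sum.swap)
  also have "\<dots> = mat_trace (Q * (R * R))"
    using Rc unfolding trace_mult[OF Q mult_carrier_mat[OF Rc Rc]]
    by (intro sum.cong refl) (simp add: mult_index_sum[OF Rc Rc] sum_distrib_left del: index_mult_mat)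
  finally show ?thesis .
qed

text \<open>For nonzero psd \<open>R\<close> this is the conditional expectation of \<open>f\<close>
  at the next residual, given that the present one is \<open>R\<close>. The finite sum keeps the
  matrix estimates free of measure theory; \<open>residual_mean_Suc\<close> links it to the
  algorithm.\<close>

definition pivot_mean :: "complex mat \<Rightarrow> (complex mat \<Rightarrow> real) \<Rightarrow> real" where
  "pivot_mean R f = (\<Sum>s<dim_row R. Re (R $$ (s, s)) / Re (mat_trace R) * f (R - pivot_update R s))"

lemma pivot_weights_sum:
  assumes R: "psd_mat n R" and nz: "R \<noteq> 0\<^sub>m n n"
  shows "(\<Sum>s<n. Re (R $$ (s, s)) / Re (mat_trace R)) = 1"
  using psd_mat_trace_pos[OF R nz] psd_carrier[OF R]
  by (simp add: trace_carrier flip: sum_divide_distrib)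

lemma pivot_mean_trace:
  assumes R: "psd_mat n R" and nz: "R \<noteq> 0\<^sub>m n n" and Q: "Q \<in> carrier_mat n n"
  shows "pivot_mean R (\<lambda>R'. Re (mat_trace (Q * R')))
    = Re (mat_trace (Q * R)) - Re (mat_trace (Q * (R * R))) / Re (mat_trace R)"
proof -
  note Rc = psd_carrier[OF R]
  define w where "w s = Re (R $$ (s, s)) / Re (mat_trace R)" for s
  have "Re (mat_trace (Q * (R - pivot_update R s))) = Re (mat_trace (Q * R)) - Re (mat_trace (Q * pivot_update R s))" for s
    using Q Rc by (simp add: mult_minus_distrib_mat[of _ n n] trace_minus[of _ n])
  then have "pivot_mean R (\<lambda>R'. Re (mat_trace (Q * R')))
    = (\<Sum>s<n. w s * Re (mat_trace (Q * R)) - w s * Re (mat_trace (Q * pivot_update R s)))"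
    using Rc unfolding pivot_mean_def w_def by (auto simp: right_diff_distrib intro!: sum.cong)
  also have "\<dots> = Re (mat_trace (Q * R)) - (\<Sum>s<n. w s * Re (mat_trace (Q * pivot_update R s)))"
    using pivot_weights_sum[OF R nz] unfolding sum_subtractf sum_distrib_right[symmetric] w_def by simp
  also have "(\<Sum>s<n. w s * Re (mat_trace (Q * pivot_update R s)))
    = (\<Sum>s<n. Re (R $$ (s, s) * mat_trace (Q * pivot_update R s))) / Re (mat_trace R)"
    unfolding sum_divide_distrib
  proof (intro sum.cong refl)
    fix s assume "s \<in> {..<n}"
    then have "Im (R $$ (s, s)) = 0" using psd_diag_real[OF R, of s] by (metis lessThan_iff Im_complex_of_real)
    then show "w s * Re (mat_trace (Q * pivot_update R s)) = Re (R $$ (s, s) * mat_trace (Q * pivot_update R s)) / Re (mat_trace R)"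
      by (simp add: w_def)
  qed
  also have "(\<Sum>s<n. Re (R $$ (s, s) * mat_trace (Q * pivot_update R s))) = Re (mat_trace (Q * (R * R)))"
    unfolding weighted_pivot_trace[OF R Q, symmetric] by (rule Re_sum[symmetric])
  finally show ?thesis .
qed

text \<open>The bound is affine in \<open>a\<close> for every \<open>t\<close>, so it survives taking expectations; optimizing
  over \<open>t\<close> only afterwards replaces Jensen's inequality.\<close>

lemma pivot_mean_proj_le:
  assumes R: "psd_mat n R" and nz: "R \<noteq> 0\<^sub>m n n" and P: "orth_proj n r P" and r: "r \<ge> 1"
    and b: "Re (mat_trace ((1\<^sub>m n - P) * R)) \<le> b"
  defines "a \<equiv> Re (mat_trace (P * R))"
  shows "pivot_mean R (\<lambda>R'. Re (mat_trace (P * R'))) \<le> a - (2 * t * a - t\<^sup>2 * (a + b)) / real r"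
proof -
  note d = orth_projD[OF P] and Rc = psd_carrier[OF R]
  define T where "T = Re (mat_trace R)"
  define w where "w = Re (mat_trace (P * (R * R)))"
  have T: "T > 0" unfolding T_def by (rule psd_mat_trace_pos[OF R nz])
  have Tab: "T \<le> a + b" using b trace_split[OF d(1) Rc] by (simp add: T_def a_def)
  have w0: "0 \<le> w" unfolding w_def
  proof -
    have "psd_mat n (R * R)"
      using psd_congruence[OF psd_one Rc] psd_herm[OF R] Rc by simp
    then show "0 \<le> Re (mat_trace (P * (R * R)))" by (rule orth_proj_trace_nonneg[OF P])
  qed
  have "a\<^sup>2 \<le> Re (mat_trace P) * w" unfolding a_def w_def by (rule orth_proj_trace_square[OF P R])
  also have "\<dots> \<le> real r * w" using d(4) w0 by (rule mult_right_mono)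
  finally have aw: "a\<^sup>2 \<le> real r * w" .
  \<comment> \<open>Tangent-line bound: \<open>a\<^sup>2 / T\<close> is at least
    \<open>2 * t * a - t\<^sup>2 * T\<close> for every \<open>t\<close>.\<close>
  have "0 \<le> (a - t * T)\<^sup>2" by simp
  also have "\<dots> = a\<^sup>2 - T * (2 * t * a - t\<^sup>2 * T)" by (simp add: power2_eq_square algebra_simps)
  finally have "T * (2 * t * a - t\<^sup>2 * T) \<le> real r * w" using aw by simp
  moreover have "t\<^sup>2 * T \<le> t\<^sup>2 * (a + b)" using Tab by (rule mult_left_mono) simp
  then have "T * (2 * t * a - t\<^sup>2 * (a + b)) \<le> T * (2 * t * a - t\<^sup>2 * T)" using T by simp
  ultimately have "(2 * t * a - t\<^sup>2 * (a + b)) / real r \<le> w / T"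
    using T r by (simp add: field_simps)
  then show ?thesis
    using pivot_mean_trace[OF R nz d(1)] by (simp add: a_def w_def T_def)
qed

section \<open>Spectral projectors\<close>

text \<open>Gram--Schmidt returns orthogonal but unnormalized vectors, so \<open>c\<close> rescales
  them. The entry formula is part of the conclusion because the first column must remain a multiple
  of a chosen eigenvector.\<close>

lemma orthonormal_columns_imp_unitary:
  fixes ws :: "complex vec list"
  assumes ws: "set ws \<subseteq> carrier_vec n" "corthogonal ws" "length ws = n"
  obtains W c where "W \<in> carrier_mat n n" "mat_adjoint W * W = 1\<^sub>m n"
    "\<And>i j. i < n \<Longrightarrow> j < n \<Longrightarrow> W $$ (i, j) = c j * (ws ! j) $ i"
proof -
  define q where "q j = (\<Sum>l<n. (cmod ((ws ! j) $ l))\<^sup>2)" for j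
  define c where "c j = complex_of_real (1 / sqrt (q j))" for j
  define W where "W = Matrix.mat n n (\<lambda>(i, j). c j * (ws ! j) $ i)"
  have W: "W \<in> carrier_mat n n" by (simp add: W_def)
  have We: "W $$ (i, j) = c j * (ws ! j) $ i" if "i < n" "j < n" for i j
    using that by (simp add: W_def)
  have car: "ws ! j \<in> carrier_vec n" if "j < n" for j using ws that by (auto simp: subset_iff)
  have self: "ws ! j \<bullet>c ws ! j = complex_of_real (q j)" if "j < n" for j
    unfolding cscalar_prod_sum[OF car[OF that] car[OF that]] q_def
    by (simp add: complex_norm_square[symmetric] del: of_real_power)
  have q: "q j > 0" if "j < n" for j
  proof -
    have "q j \<noteq> 0" using corthogonalD[OF ws(2), of j j] self[OF that] that ws(3) by auto
    moreover have "q j \<ge> 0" unfolding q_def by (intro sum_nonneg) auto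
    ultimately show ?thesis by simp
  qed
  have "mat_adjoint W * W = 1\<^sub>m n"
  proof (rule eq_matI)
    fix i j assume "i < dim_row (1\<^sub>m n :: complex mat)" "j < dim_col (1\<^sub>m n :: complex mat)"
    then have ij: "i < n" "j < n" by auto
    have "(mat_adjoint W * W) $$ (i, j) = (\<Sum>l<n. mat_adjoint W $$ (i, l) * W $$ (l, j))"
      by (rule mult_index_sum[OF adjoint_carrier[OF W] W ij])
    also have "\<dots> = (\<Sum>l<n. c j * cnj (c i) * ((ws ! j) $ l * cnj ((ws ! i) $ l)))"
      using W ij by (intro sum.cong) (auto simp: We)
    also have "\<dots> = c j * cnj (c i) * (ws ! j \<bullet>c ws ! i)"
      by (simp add: cscalar_prod_sum[OF car car] ij sum_distrib_left)
    also have "\<dots> = (if i = j then 1 else 0)"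
    proof (cases "i = j")
      case True
      have "c j * cnj (c j) * (ws ! j \<bullet>c ws ! j) = complex_of_real (1 / sqrt (q j) * (1 / sqrt (q j)) * q j)"
        unfolding self[OF ij(2)] c_def by (simp only: of_real_mult complex_cnj_complex_of_real)
      also have "1 / sqrt (q j) * (1 / sqrt (q j)) * q j = 1"
        using q[OF ij(2)] by (simp add: field_simps)
      finally show ?thesis using True by simp
    next
      case False
      then show ?thesis using corthogonalD[OF ws(2), of j i] ij ws(3) by auto
    qed
    finally show "(mat_adjoint W * W) $$ (i, j) = 1\<^sub>m n $$ (i, j)" using ij by simp
  qed (use W in auto)
  then show thesis by (rule that[OF W _ We])
qed

lemma unitary_right:
  fixes U :: "complex mat"
  assumes "U \<in> carrier_mat n n" "mat_adjoint U * U = 1\<^sub>m n"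
  shows "U * mat_adjoint U = 1\<^sub>m n"
  using mat_mult_left_right_inverse[OF adjoint_carrier[OF assms(1)] assms] .

lemma unitary_conj_mult:
  fixes U X Y :: "complex mat"
  assumes U: "U \<in> carrier_mat n n" and UU: "mat_adjoint U * U = 1\<^sub>m n"
    and X: "X \<in> carrier_mat n n" and Y: "Y \<in> carrier_mat n n"
  shows "(U * X * mat_adjoint U) * (U * Y * mat_adjoint U) = U * (X * Y) * mat_adjoint U"
proof -
  note U' = adjoint_carrier[OF U]
  have "(U * X * mat_adjoint U) * (U * Y * mat_adjoint U)
      = U * X * (mat_adjoint U * (U * Y * mat_adjoint U))"
    using U U' X Y by (intro assoc_mult_mat[of _ n n _ n _ n]) auto
  also have "mat_adjoint U * (U * Y * mat_adjoint U) = (mat_adjoint U * U) * (Y * mat_adjoint U)"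
    using U U' X Y by (simp add: assoc_mult_mat[of _ n n _ n _ n] mult_carrier_mat[of _ n n _ n])
  also have "\<dots> = Y * mat_adjoint U" using UU Y U' by simp
  also have "U * X * (Y * mat_adjoint U) = U * (X * Y) * mat_adjoint U"
    using U U' X Y by (simp add: assoc_mult_mat[of _ n n _ n _ n] mult_carrier_mat[of _ n n _ n])
  finally show ?thesis .
qed

lemma unitary_conj_cancel:
  fixes U X :: "complex mat"
  assumes U: "U \<in> carrier_mat n n" and UU: "mat_adjoint U * U = 1\<^sub>m n" and X: "X \<in> carrier_mat n n"
  shows "mat_adjoint U * (U * X * mat_adjoint U) * U = X"
proof -
  note U' = adjoint_carrier[OF U]
  have "mat_adjoint U * (U * X * mat_adjoint U) * U = (mat_adjoint U * U) * X * (mat_adjoint U * U)"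
    using U U' X by (simp add: assoc_mult_mat[of _ n n _ n _ n] mult_carrier_mat[of _ n n _ n])
  then show ?thesis using UU X by simp
qed

text \<open>Spectral theorem by induction on the roots: in a unitary basis starting with an
  eigenvector for the first root, the matrix splits into a 1-by-1 block and a smaller Hermitian
  block carrying the other roots. The order of \<open>es\<close> is free, so the eigenvalues can be
  sorted beforehand.\<close>

lemma hermitian_unitary_diag:
  fixes A :: "complex mat"
  assumes "A \<in> carrier_mat n n" "mat_adjoint A = A" "char_poly A = (\<Prod>e\<leftarrow>es. [:- e, 1:])"
  shows "\<exists>U\<in>carrier_mat n n. mat_adjoint U * U = 1\<^sub>m n \<and>
    A = U * mat_diag n (\<lambda>i. es ! i) * mat_adjoint U"
  using assms
proof (induct es arbitrary: n A)
  case Nil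
  then have "n = 0" using degree_monic_char_poly[of A n] by auto
  then show ?case using Nil(1) by (intro bexI[of _ "1\<^sub>m n"]) auto
next
  case (Cons e es n A)
  note A = Cons(2) and herm = Cons(3)
  define n1 where "n1 = n - 1"
  have cp: "char_poly A = [:- e, 1:] * (\<Prod>e\<leftarrow>es. [:- e, 1:])" using Cons(4) by simp
  have "degree (char_poly A) \<noteq> 0"
  proof -
    have "monic (\<Prod>e\<leftarrow>es. [:- e, 1:])" by (rule monic_prod_list) auto
    then show ?thesis unfolding cp by (subst degree_mult_eq) auto
  qed
  then have n: "n \<noteq> 0" using degree_monic_char_poly[OF A] by auto
  then have nn: "n = Suc n1" by (simp add: n1_def)
  have "eigenvalue A e" unfolding eigenvalue_root_char_poly[OF A] cp by simp
  from find_eigenvector[OF A this] obtain v where "eigenvector A v e" by blast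
  then have v: "v \<in> carrier_vec n" and v0: "v \<noteq> 0\<^sub>v n" and ev: "A *\<^sub>v v = e \<cdot>\<^sub>v v"
    using A unfolding eigenvector_def by auto
  interpret cof_vec_space n "TYPE(complex)" .
  define ws where "ws = gram_schmidt n (basis_completion v)"
  from basis_completion[OF v v0]
  have b: "distinct (basis_completion v)" "\<not> lin_dep (set (basis_completion v))"
    "set (basis_completion v) \<subseteq> carrier_vec n" "hd (basis_completion v) = v"
    "length (basis_completion v) = n" by auto
  then obtain vs where bv: "basis_completion v = v # vs" using n by (cases "basis_completion v") auto
  from gram_schmidt_result[OF b(3,1,2) refl, folded ws_def]
  have ws: "set ws \<subseteq> carrier_vec n" "corthogonal ws" "length ws = n" using b(5) by auto
  from gram_schmidt_hd[OF v, of vs, folded bv] have hdws: "hd ws = v" unfolding ws_def .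
  then have ws0: "ws ! 0 = v" using ws(3) n by (cases ws) auto
  obtain W c where W: "W \<in> carrier_mat n n" and WW: "mat_adjoint W * W = 1\<^sub>m n"
    and We: "\<And>i j. i < n \<Longrightarrow> j < n \<Longrightarrow> W $$ (i, j) = c j * (ws ! j) $ i"
    using orthonormal_columns_imp_unitary[OF ws] by metis
  note W' = adjoint_carrier[OF W]
  have WW': "W * mat_adjoint W = 1\<^sub>m n" by (rule unitary_right[OF W WW])
  define A' where "A' = mat_adjoint W * (A * W)"
  have A': "A' \<in> carrier_mat n n" using W W' A by (auto simp: A'_def)
  have A_A': "A = W * A' * mat_adjoint W"
  proof -
    have "W * A' * mat_adjoint W = (W * mat_adjoint W) * A * (W * mat_adjoint W)"
      using W W' A by (simp add: A'_def assoc_mult_mat[of _ n n _ n _ n] mult_carrier_mat[of _ n n _ n])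
    then show ?thesis using WW' A by simp
  qed
  have herm': "mat_adjoint A' = A'"
    unfolding A'_def adjoint_mult[OF W' mult_carrier_mat[OF A W]] adjoint_mult[OF A W] herm adjoint_adjoint
    by (rule assoc_mult_mat[OF W' A W])
  have AW0: "(A * W) $$ (l, 0) = e * W $$ (l, 0)" if l: "l < n" for l
  proof -
    have "(A * W) $$ (l, 0) = (\<Sum>k<n. A $$ (l, k) * W $$ (k, 0))"
      using l n by (intro mult_index_sum[OF A W]) auto
    also have "\<dots> = c 0 * (\<Sum>k<n. A $$ (l, k) * v $ k)"
      using n by (simp add: We ws0 sum_distrib_left mult_ac)
    also have "(\<Sum>k<n. A $$ (l, k) * v $ k) = (A *\<^sub>v v) $ l"
      using mult_mat_vec_index[OF A v l] by simp
    also have "\<dots> = e * v $ l" using ev v l by simp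
    finally show ?thesis using l n by (simp add: We ws0)
  qed
  have col0: "A' $$ (i, 0) = (if i = 0 then e else 0)" if i: "i < n" for i
  proof -
    have "A' $$ (i, 0) = (\<Sum>l<n. mat_adjoint W $$ (i, l) * (A * W) $$ (l, 0))"
      unfolding A'_def using i n by (intro mult_index_sum[OF W' mult_carrier_mat[OF A W]]) auto
    also have "\<dots> = e * (\<Sum>l<n. mat_adjoint W $$ (i, l) * W $$ (l, 0))"
      by (simp add: AW0 sum_distrib_left mult_ac del: index_mult_mat)
    also have "(\<Sum>l<n. mat_adjoint W $$ (i, l) * W $$ (l, 0)) = (mat_adjoint W * W) $$ (i, 0)"
      using i n by (intro mult_index_sum[OF W' W, symmetric]) auto
    finally show ?thesis using WW i n by simp
  qed
  \<comment> \<open>Hermitian symmetry carries the zeros of the first column over to the first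
    row.\<close>
  have row0: "A' $$ (0, j) = (if j = 0 then e else 0)" if j: "j < n" for j
  proof -
    have "A' $$ (0, j) = cnj (A' $$ (j, 0))"
      using adjoint_index[of 0 A' j] herm' A' j n by simp
    then show ?thesis using col0[OF j] col0[of 0] n by (cases "j = 0") auto
  qed
  define A3 where "A3 = Matrix.mat n1 n1 (\<lambda>(i, j). A' $$ (Suc i, Suc j))"
  define E where "E = Matrix.mat 1 1 (\<lambda>_. e)"
  have A3: "A3 \<in> carrier_mat n1 n1" and E: "E \<in> carrier_mat 1 1" by (auto simp: A3_def E_def)
  have A'_block: "A' = four_block_mat E (0\<^sub>m 1 n1) (0\<^sub>m n1 1) A3"
  proof (rule eq_matI)
    fix i j assume "i < dim_row (four_block_mat E (0\<^sub>m 1 n1) (0\<^sub>m n1 1) A3)"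
      "j < dim_col (four_block_mat E (0\<^sub>m 1 n1) (0\<^sub>m n1 1) A3)"
    then have ij: "i < n" "j < n" using nn A3 E by auto
    show "A' $$ (i, j) = four_block_mat E (0\<^sub>m 1 n1) (0\<^sub>m n1 1) A3 $$ (i, j)"
      using ij nn E A3 col0[of i] row0[of j] by (cases i; cases j) (auto simp: E_def A3_def)
  qed (use A' A3 E nn in auto)
  have herm3: "mat_adjoint A3 = A3"
  proof (rule eq_matI)
    fix i j assume "i < dim_row A3" "j < dim_col A3"
    then have ij: "i < n1" "j < n1" using A3 by auto
    then show "mat_adjoint A3 $$ (i, j) = A3 $$ (i, j)"
      using A3 adjoint_index[of "Suc i" A' "Suc j"] herm' A' nn by (auto simp: A3_def)
  qed (use A3 in auto)
  have "similar_mat A A'"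
    unfolding similar_mat_def using A A' W W' WW WW' A_A'
    by (intro exI[of _ W] exI[of _ "mat_adjoint W"] similar_mat_witI[of _ _ n]) auto
  then have "char_poly A = char_poly A'" by (rule char_poly_similar)
  also have "\<dots> = char_poly E * char_poly A3"
    unfolding A'_block by (rule char_poly_four_block_zeros_col[OF E zero_carrier_mat A3])
  also have "char_poly E = [:- e, 1:]"
    by (simp add: E_def char_poly_defs det_def sign_def)
  finally have cp3: "char_poly A3 = (\<Prod>e\<leftarrow>es. [:- e, 1:])"
    unfolding cp by (metis mult_cancel_left pCons_eq_0_iff zero_neq_one)
  from Cons(1)[OF A3 herm3 cp3] obtain V where V: "V \<in> carrier_mat n1 n1"
    and VV: "mat_adjoint V * V = 1\<^sub>m n1" and AV: "A3 = V * mat_diag n1 (\<lambda>i. es ! i) * mat_adjoint V"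
    by blast
  note V' = adjoint_carrier[OF V]
  \<comment> \<open>The diagonalizer \<open>V\<close> of the small block is extended by a leading 1,
    so that \<open>W * F\<close> diagonalizes \<open>A\<close>.\<close>
  define F where "F = four_block_mat (1\<^sub>m 1) (0\<^sub>m 1 n1) (0\<^sub>m n1 1) V"
  define D where "D = mat_diag n (\<lambda>i. (e # es) ! i)"
  have F: "F \<in> carrier_mat n n" using V nn by (auto simp: F_def)
  have D: "D \<in> carrier_mat n n" by (simp add: D_def)
  have F_adj: "mat_adjoint F = four_block_mat (1\<^sub>m 1) (0\<^sub>m 1 n1) (0\<^sub>m n1 1) (mat_adjoint V)"
  proof (rule eq_matI)
    fix i j assume "i < dim_row (four_block_mat (1\<^sub>m 1) (0\<^sub>m 1 n1) (0\<^sub>m n1 1) (mat_adjoint V))"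
      "j < dim_col (four_block_mat (1\<^sub>m 1) (0\<^sub>m 1 n1) (0\<^sub>m n1 1) (mat_adjoint V))"
    then have ij: "i < Suc n1" "j < Suc n1" using V by auto
    then show "mat_adjoint F $$ (i, j) = four_block_mat (1\<^sub>m 1) (0\<^sub>m 1 n1) (0\<^sub>m n1 1) (mat_adjoint V) $$ (i, j)"
      using V by (cases i; cases j) (auto simp: F_def)
  qed (use F V nn in auto)
  have D_block: "D = four_block_mat E (0\<^sub>m 1 n1) (0\<^sub>m n1 1) (mat_diag n1 (\<lambda>i. es ! i))"
  proof (rule eq_matI)
    fix i j assume "i < dim_row (four_block_mat E (0\<^sub>m 1 n1) (0\<^sub>m n1 1) (mat_diag n1 (\<lambda>i. es ! i)))"
      "j < dim_col (four_block_mat E (0\<^sub>m 1 n1) (0\<^sub>m n1 1) (mat_diag n1 (\<lambda>i. es ! i)))"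
    then have ij: "i < Suc n1" "j < Suc n1" using E by (auto simp: mat_diag_def)
    then show "D $$ (i, j) = four_block_mat E (0\<^sub>m 1 n1) (0\<^sub>m n1 1) (mat_diag n1 (\<lambda>i. es ! i)) $$ (i, j)"
      using E nn by (cases i; cases j) (auto simp: D_def E_def mat_diag_def)
  qed (use D E nn in \<open>auto simp: mat_diag_def\<close>)
  define K where "K = mat_diag n1 (\<lambda>i. es ! i)"
  have K: "K \<in> carrier_mat n1 n1" by (simp add: K_def)
  have FF: "mat_adjoint F * F = 1\<^sub>m n"
  proof -
    have "mat_adjoint F * F = four_block_mat (1\<^sub>m 1) (0\<^sub>m 1 n1) (0\<^sub>m n1 1) (1\<^sub>m n1)"
      unfolding F_adj unfolding F_def using V V' VV
      by (subst mult_four_block_mat[of _ 1 1 _ n1 _ n1 _ _ 1 _ n1]) auto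
    also have "\<dots> = 1\<^sub>m n" using nn by simp
    finally show ?thesis .
  qed
  have A'F: "A' = F * D * mat_adjoint F"
  proof -
    have "F * D = four_block_mat E (0\<^sub>m 1 n1) (0\<^sub>m n1 1) (V * K)"
      unfolding D_block K_def[symmetric] F_def using V E K
      by (subst mult_four_block_mat[of _ 1 1 _ n1 _ n1 _ _ 1 _ n1]) auto
    then have "F * D * mat_adjoint F
      = four_block_mat E (0\<^sub>m 1 n1) (0\<^sub>m n1 1) (V * K * mat_adjoint V)"
      unfolding F_adj using V E K V' mult_carrier_mat[OF V K]
      by (simp, subst mult_four_block_mat[of _ 1 1 _ n1 _ n1 _ _ 1 _ n1]) auto
    then show ?thesis unfolding A'_block AV K_def[symmetric] by simp
  qed
  define U where "U = W * F"
  note F' = adjoint_carrier[OF F]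
  have U: "U \<in> carrier_mat n n" using W F by (simp add: U_def)
  have U_adj: "mat_adjoint U = mat_adjoint F * mat_adjoint W" unfolding U_def by (rule adjoint_mult[OF W F])
  have "mat_adjoint U * U = mat_adjoint F * (mat_adjoint W * W) * F"
    unfolding U_adj unfolding U_def using W W' F F' by (simp add: assoc_mult_mat[of _ n n _ n _ n] mult_carrier_mat[of _ n n _ n])
  then have UU: "mat_adjoint U * U = 1\<^sub>m n" using WW FF F by simp
  have "A = U * D * mat_adjoint U"
    unfolding A_A' A'F U_adj unfolding U_def using W W' F F' D by (simp add: assoc_mult_mat[of _ n n _ n _ n] mult_carrier_mat[of _ n n _ n])
  then show ?case using U UU unfolding D_def by blast
qed

text \<open>The roots are sorted by real part before it is known that they are real. Realness
  follows afterwards, because they form the diagonal of a psd matrix congruent to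
  \<open>R\<close>.\<close>

lemma psd_eigendecomposition_exists:
  assumes R: "psd_mat n R"
  shows "\<exists>U ev. eigendecomposition n R U ev"
proof -
  note Rc = psd_carrier[OF R]
  obtain es0 where es0: "char_poly R = (\<Prod>e\<leftarrow>es0. [:- e, 1:])" "length es0 = n"
    using char_poly_factorized[OF Rc] by blast
  define es where "es = rev (sort_key Re es0)"
  have len: "length es = n" using es0 by (simp add: es_def)
  have "mset es = mset es0" by (simp add: es_def)
  then have "char_poly R = (\<Prod>e\<leftarrow>es. [:- e, 1:])"
    unfolding es0 by (metis mset_map prod_mset_prod_list)
  from hermitian_unitary_diag[OF Rc psd_herm[OF R] this]
  obtain U where U: "U \<in> carrier_mat n n" "mat_adjoint U * U = 1\<^sub>m n"
    and RU: "R = U * mat_diag n (\<lambda>i. es ! i) * mat_adjoint U" by blast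
  have "psd_mat n (mat_diag n (\<lambda>i. es ! i))"
    using psd_congruence[OF R U(1)] unitary_conj_cancel[OF U, of "mat_diag n (\<lambda>i. es ! i)"] RU by simp
  then have "es ! i = complex_of_real (Re (es ! i))" if "i < n" for i
    using psd_diag_real[of n _ i] that by (fastforce simp: mat_diag_def)
  then have "mat_diag n (\<lambda>i. es ! i) = mat_diag n (\<lambda>i. complex_of_real (Re (es ! i)))"
    by (intro eq_matI) (auto simp: mat_diag_def)
  moreover have "Re (es ! j) \<le> Re (es ! i)" if "i \<le> j" "j < n" for i j
  proof -
    have "sorted (map Re (sort_key Re es0))" by simp
    from sorted_nth_mono[OF this, of "n - Suc j" "n - Suc i"] that es0(2)
    show ?thesis by (simp add: es_def rev_nth)
  qed
  ultimately have "eigendecomposition n R U (\<lambda>i. Re (es ! i))"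
    unfolding eigendecomposition_def using U RU by simp
  then show ?thesis by blast
qed

section \<open>Ky Fan's maximum principle and the truncated eigendecomposition\<close>

lemma trace_unitary_conj:
  fixes U X :: "complex mat"
  assumes U: "U \<in> carrier_mat n n" and UU: "mat_adjoint U * U = 1\<^sub>m n" and X: "X \<in> carrier_mat n n"
  shows "mat_trace (U * X * mat_adjoint U) = mat_trace X"
proof -
  note U' = adjoint_carrier[OF U]
  have "mat_trace (U * X * mat_adjoint U) = mat_trace (mat_adjoint U * (U * X))"
    using U U' X by (intro trace_comm[of _ n n]) auto
  also have "mat_adjoint U * (U * X) = mat_adjoint U * U * X"
    by (rule assoc_mult_mat[OF U' U X, symmetric])
  finally show ?thesis using UU X by simp
qed

text \<open>In the eigenbasis the trace is the sum of the eigenvalues weighted by the diagonal of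
  \<open>M\<close>. These weights lie between 0 and 1 and add up to at most \<open>m\<close>, so it
  is best to put them on the \<open>m\<close> largest eigenvalues.\<close>

lemma eigen_trace_le:
  assumes R: "psd_mat n R" and eig: "eigendecomposition n R U ev" and Q: "orth_proj n m Q"
  shows "Re (mat_trace (Q * R)) \<le> (\<Sum>i<n. if i < m then ev i else 0)"
proof -
  have U: "U \<in> carrier_mat n n" "mat_adjoint U * U = 1\<^sub>m n"
    and mono: "\<And>i j. i \<le> j \<Longrightarrow> j < n \<Longrightarrow> ev j \<le> ev i"
    and RU: "R = U * mat_diag n (\<lambda>i. complex_of_real (ev i)) * mat_adjoint U"
    using eig by (auto simp: eigendecomposition_def)
  note U' = adjoint_carrier[OF U(1)] and d = orth_projD[OF Q]
  define D where "D = mat_diag n (\<lambda>i. complex_of_real (ev i))"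
  have D: "D \<in> carrier_mat n n" by (simp add: D_def)
  have ev0: "ev i \<ge> 0" if "i < n" for i
    using psd_mat_diag_nonneg[OF psd_congruence[OF R U(1)] that] that
      unitary_conj_cancel[OF U D] RU by (simp add: D_def mat_diag_def)
  define M where "M = mat_adjoint U * Q * U"
  have M: "M \<in> carrier_mat n n" using U U' d by (auto simp: M_def)
  have M0: "Re (M $$ (i, i)) \<ge> 0" if "i < n" for i
    unfolding M_def using psd_mat_diag_nonneg[OF psd_congruence[OF orth_proj_psd[OF Q] U(1)] that] .
  have M1: "Re (M $$ (i, i)) \<le> 1" if i: "i < n" for i
  proof -
    have "mat_adjoint U * (1\<^sub>m n - Q) * U = 1\<^sub>m n - M"
      using U U' d unfolding M_def
      by (simp add: mult_minus_distrib_mat[OF U' one_carrier_mat d(1)]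
          minus_mult_distrib_mat[OF U' mult_carrier_mat[OF U' d(1)] U(1)])
    then have "0 \<le> Re ((1\<^sub>m n - M) $$ (i, i))"
      using psd_mat_diag_nonneg[OF psd_congruence[OF orth_proj_psd[OF orth_proj_compl[OF Q]] U(1)] i] by simp
    then show ?thesis using M i by simp
  qed
  have "mat_trace M = mat_trace (U * (mat_adjoint U * Q))"
    unfolding M_def using U U' d by (intro trace_comm[of _ n n]) auto
  also have "U * (mat_adjoint U * Q) = Q"
    using unitary_right[OF U] assoc_mult_mat[OF U(1) U' d(1)] d by simp
  finally have trM: "(\<Sum>i<n. Re (M $$ (i, i))) \<le> real m"
    using d(4) unfolding trace_carrier[OF M] by (metis Re_sum)
  have "mat_trace (Q * R) = mat_trace (Q * (U * D) * mat_adjoint U)"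
    unfolding RU D_def[symmetric] using U U' d D by (simp add: assoc_mult_mat[of _ n n _ n _ n] mult_carrier_mat[of _ n n _ n])
  also have "\<dots> = mat_trace (mat_adjoint U * (Q * (U * D)))"
    using U U' d D by (intro trace_comm[of _ n n]) auto
  also have "mat_adjoint U * (Q * (U * D)) = M * D"
    unfolding M_def using U U' d D by (simp add: assoc_mult_mat[of _ n n _ n _ n] mult_carrier_mat[of _ n n _ n])
  also have "mat_trace (M * D) = (\<Sum>i<n. M $$ (i, i) * complex_of_real (ev i))"
    unfolding trace_mult[OF M D]
    by (intro sum.cong refl) (simp add: D_def mat_diag_def if_distrib sum.delta cong: if_cong)
  finally have "Re (mat_trace (Q * R)) = (\<Sum>i<n. Re (M $$ (i, i)) * ev i)" by simp
  also have "\<dots> \<le> (\<Sum>i<n. if i < m then ev i else 0)"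
  proof (cases "m < n")
    case True
    have "(\<Sum>i<n. Re (M $$ (i, i)) * ev i) - (\<Sum>i<n. if i < m then ev i else 0)
       = (\<Sum>i<n. (Re (M $$ (i, i)) - (if i < m then 1 else 0)) * ev i)"
      unfolding sum_subtractf[symmetric] by (intro sum.cong) (auto simp: algebra_simps)
    \<comment> \<open>The threshold eigenvalue \<open>ev m\<close> replaces each
      \<open>ev i\<close>: below index \<open>m\<close> the coefficient is nonpositive and
      \<open>ev i\<close> is at least \<open>ev m\<close>, and from \<open>m\<close> on both signs
      are reversed.\<close>
    also have "\<dots> \<le> (\<Sum>i<n. (Re (M $$ (i, i)) - (if i < m then 1 else 0)) * ev m)"
    proof (rule sum_mono)
      fix i assume "i \<in> {..<n}"
      then have i: "i < n" by simp
      show "(Re (M $$ (i, i)) - (if i < m then 1 else 0)) * ev i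
          \<le> (Re (M $$ (i, i)) - (if i < m then 1 else 0)) * ev m"
      proof (cases "i < m")
        case True
        then show ?thesis using mono[of i m] M1[OF i] \<open>m < n\<close> by (auto intro: mult_left_mono_neg)
      next
        case False
        then show ?thesis using mono[of m i] M0[OF i] i by (auto intro: mult_left_mono)
      qed
    qed
    also have "\<dots> = ((\<Sum>i<n. Re (M $$ (i, i))) - (\<Sum>i<n. if i < m then 1 else 0)) * ev m"
      by (simp add: sum_distrib_right[symmetric] sum_subtractf[symmetric])
    also have "(\<Sum>i<n. if i < m then 1 else 0 :: real) = real (card {i\<in>{..<n}. i < m})"
      by (simp add: sum.If_cases Int_def)
    also have "{i\<in>{..<n}. i < m} = {..<m}" using True by auto
    also have "((\<Sum>i<n. Re (M $$ (i, i))) - real (card {..<m})) * ev m \<le> 0"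
      using trM ev0[OF True] by (intro mult_nonpos_nonneg) auto
    finally show ?thesis by simp
  next
    case False
    then show ?thesis using ev0 M1 by (auto intro!: sum_mono mult_left_le_one_le M0)
  qed
  finally show ?thesis .
qed

text \<open>Whichever eigendecomposition the choice operator picks, the truncation is
  \<open>P * R\<close> for the projector \<open>P\<close> onto the leading eigenvectors. Commutation
  and optimality are recorded because deflation needs both.\<close>

lemma spectral_projector:
  assumes R: "psd_mat n R"
  shows "\<exists>P. orth_proj n m P \<and> P * R = R * P \<and> best_rank_approx m R = P * R \<and>
     (\<forall>Q. orth_proj n m Q \<longrightarrow> Re (mat_trace (Q * R)) \<le> Re (mat_trace (P * R)))"
proof -
  note Rc = psd_carrier[OF R]
  have "\<exists>B U ev. eigendecomposition (dim_row R) R U ev \<and>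
     B = U * mat_diag (dim_row R) (\<lambda>i. if i < m then complex_of_real (ev i) else 0) * mat_adjoint U"
    using psd_eigendecomposition_exists[OF R] Rc by auto
  from someI_ex[OF this, folded best_rank_approx_def]
  obtain U ev where eig: "eigendecomposition n R U ev"
    and B: "best_rank_approx m R = U * mat_diag n (\<lambda>i. if i < m then complex_of_real (ev i) else 0) * mat_adjoint U"
    using Rc by auto
  have U: "U \<in> carrier_mat n n" "mat_adjoint U * U = 1\<^sub>m n"
    and RU: "R = U * mat_diag n (\<lambda>i. complex_of_real (ev i)) * mat_adjoint U"
    using eig by (auto simp: eigendecomposition_def)
  note U' = adjoint_carrier[OF U(1)]
  define J where "J = (mat_diag n (\<lambda>i. if i < m then 1 else 0) :: complex mat)"
  define P where "P = U * J * mat_adjoint U"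
  have J: "J \<in> carrier_mat n n" by (simp add: J_def)
  have P: "P \<in> carrier_mat n n" using U U' J by (auto simp: P_def)
  have "mat_adjoint J = J" by (rule eq_matI) (auto simp: J_def mat_diag_def)
  then have P1: "mat_adjoint P = P"
    unfolding P_def adjoint_mult[OF mult_carrier_mat[OF U(1) J] U'] adjoint_mult[OF U(1) J]
    using U U' J by (simp add: assoc_mult_mat[of _ n n _ n _ n] mult_carrier_mat[of _ n n _ n])
  have JJ: "J * J = J" unfolding J_def mat_diag_diag by (rule arg_cong[of _ _ "mat_diag n"]) auto
  have P2: "P * P = P" unfolding P_def unitary_conj_mult[OF U J J] JJ ..
  have "Re (mat_trace P) = real (card {i\<in>{..<n}. i < m})"
    unfolding P_def trace_unitary_conj[OF U J]
    by (simp add: trace_carrier[OF J]) (simp add: J_def mat_diag_def if_distrib[of Re] sum.If_cases Int_def)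
  also have "\<dots> \<le> real (card {..<m})" by (intro of_nat_mono card_mono) auto
  finally have P3: "orth_proj n m P" using P P1 P2 by (simp add: orth_proj_def)
  have PR: "P * R = best_rank_approx m R"
    unfolding B unfolding RU P_def unfolding unitary_conj_mult[OF U J mat_diag_dim] unfolding J_def mat_diag_diag
    by (rule arg_cong[of _ _ "\<lambda>x. U * mat_diag n x * mat_adjoint U"]) auto
  have RP: "R * P = best_rank_approx m R"
    unfolding B unfolding RU P_def unfolding unitary_conj_mult[OF U mat_diag_dim J] unfolding J_def mat_diag_diag
    by (rule arg_cong[of _ _ "\<lambda>x. U * mat_diag n x * mat_adjoint U"]) auto
  have "Re (mat_trace (P * R)) = (\<Sum>i<n. if i < m then ev i else 0)"
    unfolding PR B trace_unitary_conj[OF U mat_diag_dim] trace_carrier[OF mat_diag_dim] Re_sum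
    by (intro sum.cong) (auto simp: mat_diag_def)
  then show ?thesis
    using P3 PR RP eigen_trace_le[OF R eig] by (intro exI[of _ P]) auto
qed

section \<open>Deflation of the spectral tail\<close>

definition tail_trace :: "nat \<Rightarrow> complex mat \<Rightarrow> real" where
  "tail_trace m R = Re (mat_trace (R - best_rank_approx m R))"

text \<open>The spectral tail as a minimum over projectors: an upper bound requires only some
  competitor \<open>Q\<close>, while the minimizer may be taken to commute with
  \<open>R\<close>.\<close>

lemma tail_trace_projector:
  assumes R: "psd_mat n R"
  shows "\<exists>P. orth_proj n m P \<and> P * R = R * P \<and>
    tail_trace m R = Re (mat_trace R) - Re (mat_trace (P * R)) \<and>
    (\<forall>Q. orth_proj n m Q \<longrightarrow> tail_trace m R \<le> Re (mat_trace R) - Re (mat_trace (Q * R)))"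
proof -
  obtain P where P: "orth_proj n m P" "P * R = R * P" "best_rank_approx m R = P * R"
    and opt: "\<And>Q. orth_proj n m Q \<Longrightarrow> Re (mat_trace (Q * R)) \<le> Re (mat_trace (P * R))"
    using spectral_projector[OF R] by blast
  have "tail_trace m R = Re (mat_trace R) - Re (mat_trace (P * R))"
    using orth_projD(1)[OF P(1)] psd_carrier[OF R]
    unfolding tail_trace_def P(3) by (simp add: trace_minus[of _ n] mult_carrier_mat[of _ n n])
  then show ?thesis using P opt by (intro exI[of _ P]) (auto intro: opt)
qed

lemma tail_trace_le:
  assumes "psd_mat n R" "orth_proj n m Q"
  shows "tail_trace m R \<le> Re (mat_trace R) - Re (mat_trace (Q * R))"
  using tail_trace_projector[OF assms(1)] assms(2) by blast

lemma tail_trace_nonneg: "psd_mat n R \<Longrightarrow> 0 \<le> tail_trace m R"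
  using tail_trace_projector[of n R m] orth_proj_trace_le by fastforce

text \<open>A projector of trace at most 0 has trace 0, and then
  \<open>orth_proj_trace_square\<close> forces \<open>Re (mat_trace (P * R))\<close> to
  vanish.\<close>

lemma trace_le_tail_0:
  assumes R: "psd_mat n R"
  shows "Re (mat_trace R) \<le> tail_trace 0 R"
proof -
  obtain P where P: "orth_proj n 0 P" "tail_trace 0 R = Re (mat_trace R) - Re (mat_trace (P * R))"
    using tail_trace_projector[OF R] by blast
  have "Re (mat_trace P) = 0"
    using psd_trace_nonneg[OF orth_proj_psd[OF P(1)]] orth_projD(4)[OF P(1)] by simp
  then show ?thesis using orth_proj_trace_square[OF P(1) R] P(2) by simp
qed

lemma commuting_proj_psd:
  assumes P: "orth_proj n m P" and R: "psd_mat n R" and PR: "P * R = R * P"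
  shows "psd_mat n (P * R)"
proof -
  note d = orth_projD[OF P] and Rc = psd_carrier[OF R]
  have "P * R * P = R * (P * P)" unfolding PR by (rule assoc_mult_mat[OF Rc d(1,1)])
  then show ?thesis using psd_congruence[OF R d(1)] unfolding d(2,3) PR by simp
qed

text \<open>For an orthogonal projector \<open>P\<close>, \<open>pivot_update P t\<close> is the orthogonal projector onto the
  line spanned by \<open>P e\<^sub>t\<close>.\<close>

context
  fixes n m t :: nat and P X :: "complex mat"
  assumes P: "orth_proj n m P" and t: "t < n" and nz: "P $$ (t, t) \<noteq> 0"
  defines "X \<equiv> pivot_update P t"
begin

private lemma P_carrier: "P \<in> carrier_mat n n" and X_carrier: "X \<in> carrier_mat n n"
  using orth_projD[OF P] by (auto simp: X_def)

private lemma P_idem: "i < n \<Longrightarrow> j < n \<Longrightarrow> (\<Sum>l<n. P $$ (i, l) * P $$ (l, j)) = P $$ (i, j)"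
  using mult_index_sum[OF P_carrier P_carrier, of i j] orth_projD(3)[OF P] by simp

private lemma X_index: "i < n \<Longrightarrow> j < n \<Longrightarrow> X $$ (i, j) = P $$ (i, t) * P $$ (t, j) / P $$ (t, t)"
  unfolding X_def by (rule pivot_update_index[OF P_carrier])

private lemma X_herm: "mat_adjoint X = X"
  unfolding X_def by (rule psd_herm[OF psd_pivot_update[OF orth_proj_psd[OF P] t]])

private lemma PX: "P * X = X"
proof (rule eq_matI)
  fix i j assume "i < dim_row X" "j < dim_col X"
  then have ij: "i < n" "j < n" using X_carrier by auto
  have "(P * X) $$ (i, j) = (\<Sum>l<n. P $$ (i, l) * P $$ (l, t)) * P $$ (t, j) / P $$ (t, t)"
    using ij unfolding mult_index_sum[OF P_carrier X_carrier ij]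
    by (simp add: X_index sum_distrib_left sum_distrib_right sum_divide_distrib mult_ac)
  then show "(P * X) $$ (i, j) = X $$ (i, j)" using P_idem[OF ij(1) t] X_index ij by simp
qed (use P_carrier X_carrier in auto)

private lemma XP: "X * P = X"
  using adjoint_mult[OF P_carrier X_carrier] orth_projD(2)[OF P] by (simp add: X_herm PX)

private lemma XX: "X * X = X"
proof (rule eq_matI)
  fix i j assume "i < dim_row X" "j < dim_col X"
  then have ij: "i < n" "j < n" using X_carrier by auto
  have "(X * X) $$ (i, j) = P $$ (i, t) * (\<Sum>l<n. P $$ (t, l) * P $$ (l, t)) * P $$ (t, j) / P $$ (t, t) / P $$ (t, t)"
    using ij unfolding mult_index_sum[OF X_carrier X_carrier ij]
    by (simp add: X_index sum_distrib_right sum_distrib_left sum_divide_distrib mult_ac)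
  then show "(X * X) $$ (i, j) = X $$ (i, j)" using P_idem[OF t t] X_index ij nz by simp
qed (use X_carrier in auto)

private lemma X_trace: "mat_trace X = 1"
proof -
  have "mat_trace X = (\<Sum>l<n. P $$ (t, l) * P $$ (l, t)) / P $$ (t, t)"
    unfolding trace_carrier[OF X_carrier] by (simp add: X_index sum_divide_distrib mult_ac)
  then show ?thesis using P_idem[OF t t] nz by simp
qed

lemma rank_one_part: "orth_proj n 1 (pivot_update P t)"
  using X_carrier X_herm XX X_trace by (simp add: orth_proj_def flip: X_def)

text \<open>Both \<open>P * X\<close> and \<open>X * P\<close> equal \<open>X\<close>, so the
  difference is again idempotent, and its trace is smaller by exactly 1.\<close>

lemma rank_one_deflation:
  assumes m: "m \<ge> 1"
  shows "orth_proj n (m - 1) (P - pivot_update P t)"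
proof -
  have "mat_adjoint (P - X) = P - X"
    using adjoint_minus[OF P_carrier X_carrier] orth_projD(2)[OF P] X_herm by simp
  moreover have "(P - X) * (P - X) = P - X"
  proof -
    have PmX: "P - X \<in> carrier_mat n n" using X_carrier by (rule minus_carrier_mat)
    have 1: "P * (P - X) = P - X"
      using mult_minus_distrib_mat[OF P_carrier P_carrier X_carrier] orth_projD(3)[OF P] PX by simp
    have 2: "X * (P - X) = 0\<^sub>m n n"
      using mult_minus_distrib_mat[OF X_carrier P_carrier X_carrier] XP XX X_carrier
      by (simp add: minus_r_inv_mat)
    show ?thesis
      unfolding minus_mult_distrib_mat[OF P_carrier X_carrier PmX] 1 2
      using P_carrier X_carrier by (intro eq_matI) auto
  qed
  moreover have "Re (mat_trace (P - X)) \<le> real (m - 1)"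
    using m orth_projD(4)[OF P] by (simp add: trace_minus[OF P_carrier X_carrier] X_trace of_nat_diff)
  ultimately show ?thesis
    using minus_carrier_mat[OF X_carrier, of P] by (simp add: orth_proj_def flip: X_def)
qed

text \<open>Being an outer product of \<open>P e\<^sub>t\<close> with itself, the projector picks
  out the diagonal entry \<open>t\<close> of \<open>P * R * P\<close>, which is \<open>P * R\<close>
  by commutation.\<close>

lemma trace_rank_one:
  assumes R: "R \<in> carrier_mat n n" and PR: "P * R = R * P"
  shows "mat_trace (pivot_update P t * R) = (P * R) $$ (t, t) / P $$ (t, t)"
proof -
  have PRc: "P * R \<in> carrier_mat n n" using P_carrier R by auto
  have "X * R = X * (P * R)"
    using XP assoc_mult_mat[OF X_carrier P_carrier R] by simp
  then have "mat_trace (X * R) = (\<Sum>i<n. \<Sum>j<n. P $$ (i, t) * P $$ (t, j) / P $$ (t, t) * (P * R) $$ (j, i))"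
    unfolding trace_mult[OF X_carrier PRc, symmetric]
    by (simp add: X_index trace_mult[OF X_carrier PRc] del: index_mult_mat)
  also have "\<dots> = (\<Sum>i<n. P $$ (i, t) * (\<Sum>j<n. P $$ (t, j) * (P * R) $$ (j, i))) / P $$ (t, t)"
    by (simp add: sum_divide_distrib sum_distrib_left mult_ac del: index_mult_mat)
  also have "(\<Sum>i<n. P $$ (i, t) * (\<Sum>j<n. P $$ (t, j) * (P * R) $$ (j, i)))
      = (\<Sum>i<n. P $$ (i, t) * (P * R) $$ (t, i))"
  proof (intro sum.cong refl)
    fix i assume "i \<in> {..<n}"
    then have i: "i < n" by simp
    have "P * (P * R) = P * R"
      using assoc_mult_mat[OF P_carrier P_carrier R] orth_projD(3)[OF P] by simp
    then show "P $$ (i, t) * (\<Sum>j<n. P $$ (t, j) * (P * R) $$ (j, i)) = P $$ (i, t) * (P * R) $$ (t, i)"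
      using mult_index_sum[OF P_carrier PRc t i] by simp
  qed
  also have "\<dots> = (P * R * P) $$ (t, t)"
    unfolding mult_index_sum[OF PRc P_carrier t t] by (simp add: mult.commute del: index_mult_mat)
  also have "P * R * P = P * R"
    using assoc_mult_mat[OF R P_carrier P_carrier] orth_projD(3)[OF P] by (simp add: PR)
  finally show ?thesis unfolding X_def .
qed

text \<open>Both factors have the form of an outer product, so the trace splits into two inner
  products of \<open>P e\<^sub>t\<close> with \<open>R e\<^sub>t\<close>, each equal to the diagonal
  entry of \<open>P * R\<close>.\<close>

lemma trace_rank_one_pivot_update:
  assumes R: "R \<in> carrier_mat n n" and PR: "P * R = R * P"
  shows "mat_trace (pivot_update P t * pivot_update R t)
    = ((P * R) $$ (t, t))\<^sup>2 / (P $$ (t, t) * R $$ (t, t))"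
proof -
  have "mat_trace (X * pivot_update R t) = (\<Sum>i<n. \<Sum>j<n. (R $$ (t, i) * P $$ (i, t)) * (P $$ (t, j) * R $$ (j, t)) / (P $$ (t, t) * R $$ (t, t)))"
    unfolding trace_mult[OF X_carrier pivot_update_carrier[OF R]]
    by (intro sum.cong refl) (simp add: X_index pivot_update_index[OF R])
  also have "\<dots> = (\<Sum>i<n. R $$ (t, i) * P $$ (i, t)) * (\<Sum>j<n. P $$ (t, j) * R $$ (j, t)) / (P $$ (t, t) * R $$ (t, t))"
    by (simp add: sum_product sum_divide_distrib)
  also have "(\<Sum>j<n. P $$ (t, j) * R $$ (j, t)) = (P * R) $$ (t, t)"
    by (rule mult_index_sum[OF P_carrier R t t, symmetric])
  also have "(\<Sum>i<n. R $$ (t, i) * P $$ (i, t)) = (P * R) $$ (t, t)"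
    unfolding PR by (rule mult_index_sum[OF R P_carrier t t, symmetric])
  finally show ?thesis by (simp add: X_def power2_eq_square)
qed

end

text \<open>Lowering the rank costs the trace of \<open>R'\<close> along the removed line. The pivot
  has already used up part of that trace if the line is \<open>P e\<^sub>s\<close>. The right-hand
  sides are chosen so that they add up over \<open>s\<close> to the spectral tail of
  \<open>R\<close>.\<close>

lemma deflation_step:
  assumes R: "psd_mat n R" and nz: "R \<noteq> 0\<^sub>m n n" and P: "orth_proj n m P" and m: "m \<ge> 1"
    and PR: "P * R = R * P" and s: "s < n"
  defines "R' \<equiv> R - pivot_update R s"
  shows "\<exists>Q. orth_proj n (m - 1) Q \<and>
    Re (R $$ (s, s)) / Re (mat_trace R) * (Re (mat_trace (P * R')) - Re (mat_trace (Q * R')))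
      \<le> Re (R $$ (s, s)) - Re ((P * R) $$ (s, s))"
proof -
  note d = orth_projD[OF P] and Rc = psd_carrier[OF R]
  define T where "T = Re (mat_trace R)"
  define \<rho> where "\<rho> = Re (R $$ (s, s))"
  define \<alpha> where "\<alpha> = Re ((P * R) $$ (s, s))"
  have T: "T > 0" unfolding T_def by (rule psd_mat_trace_pos[OF R nz])
  have \<rho>: "R $$ (s, s) = of_real \<rho>" "\<rho> \<ge> 0"
    using psd_diag_real[OF R s] psd_mat_diag_nonneg[OF R s] by (auto simp: \<rho>_def)
  have PRp: "psd_mat n (P * R)" by (rule commuting_proj_psd[OF P R PR])
  have \<alpha>: "(P * R) $$ (s, s) = of_real \<alpha>"
    using psd_diag_real[OF PRp s] by (simp add: \<alpha>_def del: index_mult_mat)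
  have \<beta>: "\<rho> - \<alpha> \<ge> 0"
  proof -
    have "(1\<^sub>m n - P) * R = R - P * R" "R * (1\<^sub>m n - P) = R - R * P"
      using minus_mult_distrib_mat[OF one_carrier_mat d(1) Rc]
        mult_minus_distrib_mat[OF Rc one_carrier_mat d(1)] Rc by auto
    then have eq: "(1\<^sub>m n - P) * R = R - P * R" and "(1\<^sub>m n - P) * R = R * (1\<^sub>m n - P)"
      using PR by auto
    then have "psd_mat n (R - P * R)"
      using commuting_proj_psd[OF orth_proj_compl[OF P] R] by simp
    then have "0 \<le> Re ((R - P * R) $$ (s, s))" by (rule psd_mat_diag_nonneg[OF _ s])
    also have "(R - P * R) $$ (s, s) = R $$ (s, s) - (P * R) $$ (s, s)"
      using d(1) Rc s by (intro index_minus_mat) auto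
    finally show ?thesis by (simp add: \<rho>_def \<alpha>_def del: index_mult_mat)
  qed
  have R'p: "psd_mat n R'" unfolding R'_def by (rule psd_pivot_residual[OF R s])
  have R'c: "R' \<in> carrier_mat n n" by (rule psd_carrier[OF R'p])
  have defl: "Re (mat_trace (P * R')) - Re (mat_trace ((P - pivot_update P t) * R'))
      = Re (mat_trace (pivot_update P t * R'))" for t
    using d(1) R'c by (simp add: minus_mult_distrib_mat[of _ n n] trace_minus[of _ n] mult_carrier_mat[of _ n n])
  \<comment> \<open>The line to remove is \<open>P e\<^sub>s\<close> if this is nonzero, otherwise
    any other nonzero \<open>P e\<^sub>t\<close>; if none exists, \<open>P\<close> has trace 0 and
    is kept.\<close>
  consider (same) "P $$ (s, s) \<noteq> 0" | (other) t where "P $$ (s, s) = 0" "t < n" "P $$ (t, t) \<noteq> 0"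
    | (zero) "\<And>t. t < n \<Longrightarrow> P $$ (t, t) = 0" by blast
  then show ?thesis
  proof cases
    case same
    note X = rank_one_part[OF P s same] and Q = rank_one_deflation[OF P s same m]
    define p where "p = Re (P $$ (s, s))"
    have p: "P $$ (s, s) = of_real p"
      using psd_diag_real[OF orth_proj_psd[OF P] s] by (simp add: p_def)
    have trX: "mat_trace (pivot_update P s * R) = of_real (\<alpha> / p)"
      using trace_rank_one[OF P s same Rc PR] \<alpha> p by simp
    have le: "\<alpha> / p \<le> T" using orth_proj_trace_le[OF X R] trX by (simp add: T_def)
    have "mat_trace (pivot_update P s * R')
      = mat_trace (pivot_update P s * R) - mat_trace (pivot_update P s * pivot_update R s)"
      unfolding R'_def using d(1) Rc
      by (simp add: mult_minus_distrib_mat[of _ n n] trace_minus[of _ n] mult_carrier_mat[of _ n n])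
    also have "\<dots> = of_real (\<alpha> / p - \<alpha>\<^sup>2 / (p * \<rho>))"
      unfolding trX trace_rank_one_pivot_update[OF P s same Rc PR] \<alpha> p \<rho>(1) by simp
    finally have tr: "Re (mat_trace (pivot_update P s * R')) = \<alpha> / p - \<alpha>\<^sup>2 / (p * \<rho>)" by simp
    have "\<rho> / T * (\<alpha> / p - \<alpha>\<^sup>2 / (p * \<rho>)) \<le> \<rho> - \<alpha>"
    proof (cases "\<rho> = 0")
      case True
      then show ?thesis using \<beta> by simp
    next
      case False
      \<comment> \<open>Here \<open>\<alpha> / p\<close> is the trace of \<open>R\<close> along the
        line, so its ratio to the full trace \<open>T\<close> is at most 1.\<close>
      have "\<rho> / T * (\<alpha> / p - \<alpha>\<^sup>2 / (p * \<rho>)) = (\<alpha> / p) / T * (\<rho> - \<alpha>)"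
        using False T by (cases "p = 0") (auto simp: field_simps power2_eq_square)
      also have "\<dots> \<le> 1 * (\<rho> - \<alpha>)"
      proof (rule mult_right_mono[OF _ \<beta>])
        show "\<alpha> / p / T \<le> 1" using le T by (subst pos_divide_le_eq) auto
      qed
      finally show ?thesis by simp
    qed
    then show ?thesis
      using Q defl[of s] tr by (intro exI[of _ "P - pivot_update P s"]) (simp add: \<rho>_def \<alpha>_def T_def)
  next
    case other
    note X = rank_one_part[OF P other(2,3)] and Q = rank_one_deflation[OF P other(2,3) m]
    \<comment> \<open>A zero diagonal entry of the psd matrix \<open>P\<close> kills its whole row,
      hence \<open>\<alpha> = 0\<close>. The crude cost \<open>T\<close> then suffices, since the
      weight turns it into \<open>\<rho>\<close>.\<close>
    have row: "P $$ (s, j) = 0" if "j < n" for j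
      using psd_diag_zero[OF orth_proj_psd[OF P] that s other(1)]
        psd_mat_sym[OF orth_proj_psd[OF P] that s] by simp
    have "\<alpha> = 0" unfolding \<alpha>_def mult_index_sum[OF d(1) Rc s s] by (simp add: row)
    moreover have "Re (mat_trace (pivot_update P t * R')) \<le> T"
      using pivot_residual_trace_le[OF X R s] orth_proj_trace_le[OF X R] by (simp add: R'_def T_def)
    then have "\<rho> / T * Re (mat_trace (pivot_update P t * R')) \<le> \<rho> / T * T"
      using \<rho>(2) T by (intro mult_left_mono) auto
    ultimately show ?thesis
      using Q defl[of t] T by (intro exI[of _ "P - pivot_update P t"]) (simp add: \<rho>_def \<alpha>_def T_def)
  next
    case zero
    then have "mat_trace P = 0" by (simp add: trace_carrier[OF d(1)])
    then have "orth_proj n (m - 1) P" using d by (simp add: orth_proj_def)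
    then show ?thesis using \<beta> by (intro exI[of _ P]) (simp add: \<rho>_def \<alpha>_def)
  qed
qed

text \<open>The factor 2 has two sources, each contributing one \<open>tail_trace m R\<close>: the
  error left by the undeflated \<open>P\<close>, which does not grow in a step, and the deflation
  costs summed over all pivots.\<close>

lemma pivot_mean_tail_le:
  assumes R: "psd_mat n R" and nz: "R \<noteq> 0\<^sub>m n n" and m: "m \<ge> 1"
  shows "pivot_mean R (tail_trace (m - 1)) \<le> 2 * tail_trace m R"
proof -
  note Rc = psd_carrier[OF R]
  obtain P where P: "orth_proj n m P" "P * R = R * P"
    and tail: "tail_trace m R = Re (mat_trace R) - Re (mat_trace (P * R))"
    using tail_trace_projector[OF R] by blast
  note d = orth_projD[OF P(1)]
  define w where "w s = Re (R $$ (s, s)) / Re (mat_trace R)" for s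
  have w: "w s \<ge> 0" if "s < n" for s
    using psd_mat_diag_nonneg[OF R that] psd_trace_nonneg[OF R] by (simp add: w_def)
  have bound: "w s * tail_trace (m - 1) (R - pivot_update R s)
      \<le> w s * tail_trace m R + (Re (R $$ (s, s)) - Re ((P * R) $$ (s, s)))" if s: "s < n" for s
  proof -
    define R' where "R' = R - pivot_update R s"
    have R'p: "psd_mat n R'" unfolding R'_def by (rule psd_pivot_residual[OF R s])
    obtain Q where Q: "orth_proj n (m - 1) Q"
      and le: "w s * (Re (mat_trace (P * R')) - Re (mat_trace (Q * R'))) \<le> Re (R $$ (s, s)) - Re ((P * R) $$ (s, s))"
      using deflation_step[OF R nz P(1) m P(2) s] unfolding R'_def w_def by blast
    have "Re (mat_trace R') - Re (mat_trace (P * R')) \<le> tail_trace m R"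
      using pivot_residual_trace_le[OF orth_proj_compl[OF P(1)] R s]
      by (simp add: tail trace_split[OF d(1) Rc] trace_split[OF d(1) psd_carrier[OF R'p]] flip: R'_def)
    then have "w s * (Re (mat_trace R') - Re (mat_trace (P * R'))) \<le> w s * tail_trace m R"
      using w[OF s] by (rule mult_left_mono)
    moreover have "w s * tail_trace (m - 1) R' \<le> w s * (Re (mat_trace R') - Re (mat_trace (Q * R')))"
      using tail_trace_le[OF R'p Q] w[OF s] by (rule mult_left_mono)
    ultimately show ?thesis using le by (simp add: right_diff_distrib flip: R'_def)
  qed
  have "pivot_mean R (tail_trace (m - 1)) = (\<Sum>s<n. w s * tail_trace (m - 1) (R - pivot_update R s))"
    using Rc by (simp add: pivot_mean_def w_def)
  also have "\<dots>
      \<le> (\<Sum>s<n. w s * tail_trace m R + (Re (R $$ (s, s)) - Re ((P * R) $$ (s, s))))"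
    by (rule sum_mono) (rule bound, simp)
  also have "\<dots> = (\<Sum>s<n. w s) * tail_trace m R + ((\<Sum>s<n. Re (R $$ (s, s))) - (\<Sum>s<n. Re ((P * R) $$ (s, s))))"
    by (simp only: sum.distrib sum_subtractf sum_distrib_right)
  also have "(\<Sum>s<n. w s) = 1" unfolding w_def by (rule pivot_weights_sum[OF R nz])
  also have "(\<Sum>s<n. Re (R $$ (s, s))) = Re (mat_trace R)" by (simp add: trace_carrier[OF Rc])
  also have "(\<Sum>s<n. Re ((P * R) $$ (s, s))) = Re (mat_trace (P * R))"
    unfolding trace_carrier[OF mult_carrier_mat[OF d(1) Rc]] by (rule Re_sum[symmetric])
  finally show ?thesis using tail by simp
qed

section \<open>Expectations along the algorithm\<close>

lemma set_pivot_pmf_subset: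
  assumes "psd_mat n R" "R \<noteq> 0\<^sub>m n n"
  shows "set_pmf (pivot_pmf R) \<subseteq> {..<n}"
  using pmf_pivot[OF assms] by (auto simp: set_pmf_iff split: if_splits)

text \<open>Finite support turns every expectation into a finite sum. That \<open>A - R\<close>
  stays psd, as each step adds a psd update to it, is what later bounds traces of residuals by those
  of \<open>A\<close>.\<close>

lemma rp_cholesky_support:
  assumes A: "psd_mat n A"
  shows "finite (set_pmf (rp_cholesky A i)) \<and>
    (\<forall>(Ahat, R)\<in>set_pmf (rp_cholesky A i). psd_mat n R \<and> psd_mat n (A - R) \<and>
       Ahat \<in> carrier_mat n n \<and> A - Ahat = R)"
proof (induction i)
  case 0
  have "A - A = 0\<^sub>m n n" "A - 0\<^sub>m n n = A" using psd_carrier[OF A] by auto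
  then show ?case using A psd_zero[of n] psd_carrier[OF A] by auto
next
  case (Suc i)
  have Ac: "A \<in> carrier_mat n n" by (rule psd_carrier[OF A])
  show ?case
  proof (intro conjI)
    show "finite (set_pmf (rp_cholesky A (Suc i)))"
      using Suc Ac
      by (auto intro!: finite_imageI finite_subset[OF set_pivot_pmf_subset[of n] finite_lessThan])
    show "\<forall>(Ahat, R)\<in>set_pmf (rp_cholesky A (Suc i)). psd_mat n R \<and> psd_mat n (A - R) \<and>
       Ahat \<in> carrier_mat n n \<and> A - Ahat = R"
    proof clarify
      fix B S assume "(B, S) \<in> set_pmf (rp_cholesky A (Suc i))"
      then obtain Ahat R where mem: "(Ahat, R) \<in> set_pmf (rp_cholesky A i)"
        and BS: "(B, S) \<in> set_pmf (if R = 0\<^sub>m n n then return_pmf (Ahat, R)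
          else map_pmf (\<lambda>s. (Ahat + pivot_update R s, R - pivot_update R s)) (pivot_pmf R))"
        using Ac by auto
      have IH: "psd_mat n R" "psd_mat n (A - R)" "Ahat \<in> carrier_mat n n" "A - Ahat = R"
        using Suc mem by auto
      note Rc = psd_carrier[OF IH(1)]
      show "psd_mat n S \<and> psd_mat n (A - S) \<and> B \<in> carrier_mat n n \<and> A - B = S"
      proof (cases "R = 0\<^sub>m n n")
        case True
        then show ?thesis using BS IH by simp
      next
        case False
        with BS obtain s where s: "s \<in> set_pmf (pivot_pmf R)"
          and B: "B = Ahat + pivot_update R s" and S: "S = R - pivot_update R s" by auto
        have sn: "s < n" using set_pivot_pmf_subset[OF IH(1) False] s by auto
        have "A - S = (A - R) + pivot_update R s"
          unfolding S using Ac Rc by (intro eq_matI) auto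
        then have "psd_mat n (A - S)"
          using psd_add[OF IH(2) psd_pivot_update[OF IH(1) sn]] by simp
        moreover have "A - B = (A - Ahat) - pivot_update R s"
          unfolding B using Ac IH(3) Rc by (intro eq_matI) auto
        then have "A - B = S" unfolding IH(4) S .
        ultimately show ?thesis
          using psd_pivot_residual[OF IH(1) sn] IH(3) pivot_update_carrier[OF Rc, of s]
          by (auto simp: S B)
      qed
    qed
  qed
qed

definition residual_mean :: "complex mat \<Rightarrow> nat \<Rightarrow> (complex mat \<Rightarrow> real) \<Rightarrow> real" where
  "residual_mean A i f = measure_pmf.expectation (rp_cholesky A i) (\<lambda>(Ahat, R). f R)"

lemma residual_mean_sum:
  assumes A: "psd_mat n A"
  shows "residual_mean A i f
    = (\<Sum>x\<in>set_pmf (rp_cholesky A i). pmf (rp_cholesky A i) x * f (snd x))"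
  unfolding residual_mean_def using rp_cholesky_support[OF A, of i]
  by (subst integral_measure_pmf[of "set_pmf (rp_cholesky A i)"]) (auto simp: case_prod_unfold)

lemma residual_mean_mono:
  assumes A: "psd_mat n A"
    and le: "\<And>R. psd_mat n R \<Longrightarrow> psd_mat n (A - R) \<Longrightarrow> f R \<le> g R"
  shows "residual_mean A i f \<le> residual_mean A i g"
  unfolding residual_mean_sum[OF A] using rp_cholesky_support[OF A, of i]
  by (intro sum_mono mult_left_mono le) auto

lemma residual_mean_affine:
  assumes A: "psd_mat n A"
  shows "residual_mean A i (\<lambda>R. c + d * f R) = c + d * residual_mean A i f"
proof -
  have "(\<Sum>x\<in>set_pmf (rp_cholesky A i). pmf (rp_cholesky A i) x) = 1"
    using rp_cholesky_support[OF A, of i] by (intro sum_pmf_eq_1) auto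
  then show ?thesis
    unfolding residual_mean_sum[OF A]
    by (simp add: distrib_left sum.distrib mult.left_commute[of _ d] flip: sum_distrib_left sum_distrib_right)
qed

lemma residual_mean_0: "residual_mean A 0 f = f A"
  by (simp add: residual_mean_def)

text \<open>Total expectation, conditioning on the state after \<open>i\<close> steps; the zero
  residual is absorbing and is therefore treated separately.\<close>

lemma residual_mean_Suc:
  assumes A: "psd_mat n A"
  shows "residual_mean A (Suc i) f
    = residual_mean A i (\<lambda>R. if R = 0\<^sub>m n n then f R else pivot_mean R f)"
proof -
  define S where "S = set_pmf (rp_cholesky A i)"
  define K where "K = (\<lambda>(Ahat, R). if R = 0\<^sub>m (dim_row A) (dim_col A) then return_pmf (Ahat, R)
     else map_pmf (\<lambda>s. (Ahat + pivot_update R s, R - pivot_update R s)) (pivot_pmf R))"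
  have Ac: "A \<in> carrier_mat n n" by (rule psd_carrier[OF A])
  have S: "finite S" "\<And>x. x \<in> S \<Longrightarrow> psd_mat n (snd x)"
    using rp_cholesky_support[OF A, of i] by (auto simp: S_def)
  have K_mean: "finite (set_pmf (K x))" "measure_pmf.expectation (K x) (\<lambda>(Ahat, R). f R)
      = (if snd x = 0\<^sub>m n n then f (snd x) else pivot_mean (snd x) f)" if "x \<in> S" for x
  proof -
    obtain Ahat R where x: "x = (Ahat, R)" by (cases x)
    have R: "psd_mat n R" using S(2)[OF that] x by simp
    have fin: "set_pmf (pivot_pmf R) \<subseteq> {..<n}" if "R \<noteq> 0\<^sub>m n n"
      by (rule set_pivot_pmf_subset[OF R that])
    show "finite (set_pmf (K x))"
      using Ac fin by (auto simp: K_def x intro: finite_subset)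
    have "measure_pmf.expectation (pivot_pmf R) (\<lambda>s. f (R - pivot_update R s)) = pivot_mean R f"
      if nz: "R \<noteq> 0\<^sub>m n n"
      using fin[OF nz] psd_carrier[OF R]
      by (subst integral_measure_pmf[of "{..<n}"]) (auto simp: pmf_pivot[OF R nz] pivot_mean_def)
    then show "measure_pmf.expectation (K x) (\<lambda>(Ahat, R). f R)
      = (if snd x = 0\<^sub>m n n then f (snd x) else pivot_mean (snd x) f)"
      using Ac by (auto simp: K_def x)
  qed
  have "residual_mean A (Suc i) f = measure_pmf.expectation (rp_cholesky A i \<bind> K) (\<lambda>(Ahat, R). f R)"
    by (simp add: residual_mean_def K_def)
  also have "\<dots> = (\<Sum>x\<in>S. pmf (rp_cholesky A i) x *\<^sub>R measure_pmf.expectation (K x) (\<lambda>(Ahat, R). f R))"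
    using S K_mean by (intro pmf_expectation_bind) (auto simp: S_def)
  also have "\<dots> = residual_mean A i (\<lambda>R. if R = 0\<^sub>m n n then f R else pivot_mean R f)"
    unfolding residual_mean_sum[OF A] S_def[symmetric] by (intro sum.cong refl) (simp add: K_mean)
  finally show ?thesis .
qed

text \<open>Each step trades one unit of rank for a factor 2. At an absorbed zero residual all tails
  vanish.\<close>

lemma residual_mean_tail_le:
  assumes A: "psd_mat n A"
  shows "i \<le> r \<Longrightarrow> residual_mean A i (tail_trace (r - i)) \<le> 2 ^ i * tail_trace r A"
proof (induction i)
  case 0
  then show ?case by (simp add: residual_mean_0)
next
  case (Suc i)
  have "residual_mean A (Suc i) (tail_trace (r - Suc i)) \<le> residual_mean A i (\<lambda>R. 0 + 2 * tail_trace (r - i) R)"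
    unfolding residual_mean_Suc[OF A]
  proof (rule residual_mean_mono[OF A])
    fix R assume R: "psd_mat n R"
    show "(if R = 0\<^sub>m n n then tail_trace (r - Suc i) R else pivot_mean R (tail_trace (r - Suc i)))
      \<le> 0 + 2 * tail_trace (r - i) R"
    proof (cases "R = 0\<^sub>m n n")
      case True
      have "tail_trace (r - Suc i) R \<le> Re (mat_trace R)"
        using tail_trace_projector[OF R, of "r - Suc i"] orth_proj_trace_nonneg R by fastforce
      also have "\<dots> = 0" using True by (simp add: mat_trace_def)
      finally show ?thesis using True tail_trace_nonneg[OF R, of "r - i"] by simp
    next
      case False
      then show ?thesis using pivot_mean_tail_le[OF R False, of "r - i"] Suc.prems by (simp add: diff_diff_eq)
    qed
  qed
  also have "\<dots> = 2 * residual_mean A i (tail_trace (r - i))"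
    by (subst residual_mean_affine[OF A]) simp
  finally show ?case using Suc by simp
qed

text \<open>After \<open>r\<close> trades the rank is used up, and the rank-0 tail dominates the
  whole trace.\<close>

lemma residual_mean_trace_doubling:
  assumes A: "psd_mat n A"
  shows "residual_mean A r (\<lambda>R. Re (mat_trace R)) \<le> 2 ^ r * tail_trace r A"
proof -
  have "residual_mean A r (\<lambda>R. Re (mat_trace R)) \<le> residual_mean A r (tail_trace (r - r))"
    by (rule residual_mean_mono[OF A]) (simp add: trace_le_tail_0)
  also have "\<dots> \<le> 2 ^ r * tail_trace r A" by (rule residual_mean_tail_le[OF A]) simp
  finally show ?thesis .
qed

lemma residual_mean_proj_step:
  assumes A: "psd_mat n A" and P: "orth_proj n r P" and r: "r \<ge> 1"
  defines "b \<equiv> Re (mat_trace ((1\<^sub>m n - P) * A))"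
    and "x \<equiv> (\<lambda>i. residual_mean A i (\<lambda>R. Re (mat_trace (P * R))))"
  shows "x (Suc i) \<le> x i - (x i)\<^sup>2 / (real r * (x i + b))"
proof -
  \<comment> \<open>The maximizer of \<open>2 * t * x i - t\<^sup>2 * (x i + b)\<close> when
    \<open>x i + b\<close> is positive. It depends only on the mean, so the one-step bound stays
    affine in the random trace.\<close>
  define t where "t = x i / (x i + b)"
  have b0: "b \<ge> 0" unfolding b_def by (rule orth_proj_trace_nonneg[OF orth_proj_compl[OF P] A])
  have "x (Suc i) \<le> residual_mean A i (\<lambda>R. t\<^sup>2 * b / real r + (1 - (2 * t - t\<^sup>2) / real r) * Re (mat_trace (P * R)))"
    unfolding x_def residual_mean_Suc[OF A]
  proof (rule residual_mean_mono[OF A])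
    fix R assume R: "psd_mat n R" and AR: "psd_mat n (A - R)"
    have Rc: "R \<in> carrier_mat n n" by (rule psd_carrier[OF R])
    have b: "Re (mat_trace ((1\<^sub>m n - P) * R)) \<le> b"
      unfolding b_def by (rule orth_proj_trace_mono[OF orth_proj_compl[OF P] psd_carrier[OF A] Rc AR])
    show "(if R = 0\<^sub>m n n then Re (mat_trace (P * R)) else pivot_mean R (\<lambda>R. Re (mat_trace (P * R))))
      \<le> t\<^sup>2 * b / real r + (1 - (2 * t - t\<^sup>2) / real r) * Re (mat_trace (P * R))"
    proof (cases "R = 0\<^sub>m n n")
      case True
      have "P * R = 0\<^sub>m n n" unfolding True by (rule right_mult_zero_mat[OF orth_projD(1)[OF P]])
      then have "Re (mat_trace (P * R)) = 0" by (simp add: mat_trace_def)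
      then show ?thesis using True b0 by simp
    next
      case False
      then show ?thesis
        using pivot_mean_proj_le[OF R False P r b, of t] r by (simp add: field_simps)
    qed
  qed
  also have "\<dots> = t\<^sup>2 * b / real r + (1 - (2 * t - t\<^sup>2) / real r) * x i"
    unfolding x_def by (rule residual_mean_affine[OF A])
  also have "\<dots> = x i - (2 * t * x i - t\<^sup>2 * (x i + b)) / real r"
    using r by (simp add: field_simps)
  also have "2 * t * x i - t\<^sup>2 * (x i + b) = (x i)\<^sup>2 / (x i + b)"
  \<comment> \<open>If the denominator is 0, division by zero makes both \<open>t\<close> and the
    right-hand side 0.\<close>
  proof (cases "x i + b = 0")
    case False
    then have "t * (x i + b) = x i" by (simp add: t_def)
    then have "2 * t * x i - t\<^sup>2 * (x i + b) = t * x i" by (simp add: power2_eq_square mult.assoc)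
    then show ?thesis by (simp add: t_def power2_eq_square)
  qed (simp add: t_def)
  finally show ?thesis by (simp add: mult.commute)
qed

section \<open>The scalar recursion and its potential\<close>

text \<open>If \<open>x k\<close> were above the threshold, so would be all earlier terms, the
  sequence being decreasing. The potential \<open>F\<close> would then drop by 1 in each of
  \<open>k\<close> steps and end too low for its monotonicity.\<close>

lemma recursion_below_threshold:
  fixes x :: "nat \<Rightarrow> real"
  assumes step: "\<And>i. x (Suc i) \<le> x i - (x i)\<^sup>2 / (r * (x i + b))"
    and nonneg: "\<And>i. 0 \<le> x i" and b: "b > 0" and r: "r > 0" and \<epsilon>: "\<epsilon> > 0" and c: "x 0 \<le> c"
    and k: "real k \<ge> r / \<epsilon> + r * ln (c / (\<epsilon> * b))"
  shows "x k \<le> \<epsilon> * b"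
proof (rule ccontr)
  assume "\<not> x k \<le> \<epsilon> * b"
  then have xk: "\<epsilon> * b < x k" by simp
  \<comment> \<open>Obtained by separating variables in the differential equation with rate
    \<open>- y\<^sup>2 / (r * (y + b))\<close>: the derivative of \<open>F\<close> is
    \<open>r * (y + b) / y\<^sup>2\<close>.\<close>
  define F where "F y = r * ln y - r * b / y" for y
  have \<epsilon>b: "\<epsilon> * b > 0" using \<epsilon> b by simp
  have "x (Suc i) \<le> x i" for i
  proof -
    have "0 \<le> (x i)\<^sup>2 / (r * (x i + b))" using nonneg[of i] b r by simp
    then show ?thesis using step[of i] by linarith
  qed
  then have anti: "antimono x" by (rule decseq_SucI)
  have pos: "x i > 0" if "i \<le> k" for i
    using antimonoD[OF anti that] xk \<epsilon>b by linarith
  have F_step: "F (x (Suc i)) \<le> F (x i) - 1" if i: "Suc i \<le> k" for i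
  proof -
    define y where "y = x i"
    define z where "z = x (Suc i)"
    have y: "y > 0" and z: "z > 0" using pos[of i] pos[OF i] i by (auto simp: y_def z_def)
    have zy: "z \<le> y - y\<^sup>2 / (r * (y + b))" unfolding y_def z_def by (rule step)
    \<comment> \<open>The facts \<open>1\<close> and \<open>2\<close> are the tangent bounds at
      \<open>y\<close> for the two concave summands of \<open>F\<close>.\<close>
    have "ln (z / y) \<le> z / y - 1" by (rule ln_le_minus_one) (use y z in auto)
    then have 1: "ln z - ln y \<le> (z - y) / y" using y z by (simp add: ln_div diff_divide_distrib)
    have 2: "b / y - b / z \<le> b * (z - y) / y\<^sup>2"
    proof -
      have "b * (z - y) / y\<^sup>2 - (b / y - b / z) = b * (z - y)\<^sup>2 / (y\<^sup>2 * z)"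
        using y z by (simp add: field_simps power2_eq_square)
      also have "\<dots> \<ge> 0" using b z by simp
      finally show ?thesis by simp
    qed
    have "F z - F y = r * ((ln z - ln y) + (b / y - b / z))"
      by (simp add: F_def algebra_simps)
    also have "\<dots> \<le> r * ((z - y) / y + b * (z - y) / y\<^sup>2)"
      using 1 2 r by (intro mult_left_mono) auto
    also have "\<dots> = r * (y + b) / y\<^sup>2 * (z - y)"
      using y by (simp add: field_simps power2_eq_square)
    also have "\<dots> \<le> r * (y + b) / y\<^sup>2 * (- (y\<^sup>2 / (r * (y + b))))"
      using zy y b r by (intro mult_left_mono) auto
    also have "\<dots> = - 1"
    proof -
      have "r * (y + b) \<noteq> 0" using y b r by simp
      then show ?thesis using y by simp
    qed
    finally show ?thesis by (simp add: y_def z_def)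
  qed
  have "i \<le> k \<Longrightarrow> F (x i) \<le> F (x 0) - real i" for i
  proof (induction i)
    case (Suc i)
    then show ?case using F_step[of i] by simp
  qed simp
  from this[of k] have "F (x k) \<le> F (x 0) - real k" by simp
  also have "F (x 0) \<le> r * ln c"
  proof -
    have "F (x 0) \<le> r * ln (x 0)" using pos[of 0] b r by (simp add: F_def)
    also have "\<dots> \<le> r * ln c" using pos[of 0] c r by simp
    finally show ?thesis .
  qed
  finally have "F (x k) \<le> r * ln c - real k" by simp
  also have "\<dots> \<le> r * ln (\<epsilon> * b) - r / \<epsilon>"
    using k pos[of 0] c \<epsilon> b r by (simp add: ln_div right_diff_distrib)
  \<comment> \<open>The second summand of \<open>F\<close> at the threshold is exactly the term
    \<open>r / \<epsilon>\<close> in the condition on \<open>k\<close>.\<close>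
  also have "\<dots> = F (\<epsilon> * b)" using b by (simp add: F_def)
  also have "\<dots> < F (x k)"
  proof -
    have "ln (\<epsilon> * b) < ln (x k)" using xk \<epsilon>b by simp
    moreover have "b / x k < b / (\<epsilon> * b)" using xk \<epsilon>b b by (intro divide_strict_left_mono) auto
    ultimately have "r * ln (\<epsilon> * b) < r * ln (x k)" "r * (b / x k) < r * (b / (\<epsilon> * b))"
      using r by (blast intro: mult_strict_left_mono)+
    then show ?thesis using b by (simp add: F_def)
  qed
  finally show False by simp
qed

section \<open>From the recursion to the two sufficient step counts\<close>

theorem theorem5p1:
  fixes N r k :: nat and A :: "complex mat" and \<epsilon> :: real
  assumes "psd_mat N A" and "A \<noteq> 0\<^sub>m N N"
    and "r \<ge> 1" and "\<epsilon> > 0"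
    and "ereal (real k) \<ge> ereal (real r / \<epsilon>) +
           min (ereal (real r) * log_recip (\<epsilon> * rel_error r A))
               (ereal (real r + real r * log_plus (2 ^ r / \<epsilon>)))"
  shows "measure_pmf.expectation (rp_cholesky A k) (\<lambda>(Ahat, R). Re (mat_trace (A - Ahat)))
           \<le> (1 + \<epsilon>) * Re (mat_trace (A - best_rank_approx r A))"
proof -
  note A = assms(1) and r = assms(3) and \<epsilon> = assms(4)
  have Ac: "A \<in> carrier_mat N N" by (rule psd_carrier[OF A])
  obtain P where P: "orth_proj N r P"
    and tail: "tail_trace r A = Re (mat_trace A) - Re (mat_trace (P * A))"
    using tail_trace_projector[OF A] by blast
  define b where "b = tail_trace r A"
  define T where "T = Re (mat_trace A)"
  define x where "x i = residual_mean A i (\<lambda>R. Re (mat_trace (P * R)))" for i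
  have b_eq: "b = Re (mat_trace ((1\<^sub>m N - P) * A))"
    by (simp add: b_def tail trace_split[OF orth_projD(1)[OF P] Ac])
  have b0: "b \<ge> 0" unfolding b_def by (rule tail_trace_nonneg[OF A])
  have T: "T > 0" unfolding T_def by (rule psd_mat_trace_pos[OF A assms(2)])
  have step: "x (Suc i) \<le> x i - (x i)\<^sup>2 / (real r * (x i + b))" for i
    unfolding x_def b_eq by (rule residual_mean_proj_step[OF A P r])
  have x0: "0 \<le> x i" for i
  proof -
    have "residual_mean A i (\<lambda>R. 0 + 0 * Re (mat_trace R)) \<le> x i"
      unfolding x_def by (rule residual_mean_mono[OF A]) (simp add: orth_proj_trace_nonneg[OF P])
    then show ?thesis by (simp only: residual_mean_affine[OF A])
  qed
  have "x k \<le> \<epsilon> * b"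
  proof (cases "ereal (real r) * log_recip (\<epsilon> * rel_error r A) < ereal (real r + real r * log_plus (2 ^ r / \<epsilon>))")
    case True
    have \<eta>: "rel_error r A = b / T"
      by (simp add: rel_error_def b_def T_def tail_trace_def)
    \<comment> \<open>For zero relative error \<open>log_recip\<close> is infinite and could not be
      the strictly smaller term. Hence \<open>b\<close> is positive in this case.\<close>
    have "\<epsilon> * rel_error r A \<noteq> 0"
    proof
      assume "\<epsilon> * rel_error r A = 0"
      then show False using True r by (simp add: log_recip_def)
    qed
    then have b: "b > 0" using \<eta> b0 \<epsilon> by auto
    then have "log_recip (\<epsilon> * rel_error r A) = ereal (ln (T / (\<epsilon> * b)))"
      using T \<epsilon> by (simp add: log_recip_def \<eta>)
    then have k: "real k \<ge> real r / \<epsilon> + real r * ln (T / (\<epsilon> * b))"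
      using assms(5) True by (simp add: min_def)
    have "x 0 \<le> T"
      unfolding x_def T_def residual_mean_0 by (rule orth_proj_trace_le[OF P A])
    then show ?thesis
      using recursion_below_threshold[of x "real r" b \<epsilon> T k] step x0 b r \<epsilon> k by simp
  next
    case False
    then have k: "real k \<ge> real r / \<epsilon> + (real r + real r * log_plus (2 ^ r / \<epsilon>))"
      using assms(5) by (simp add: min_def split: if_splits)
    have L: "log_plus (2 ^ r / \<epsilon>) \<ge> 0" "log_plus (2 ^ r / \<epsilon>) \<ge> ln (2 ^ r / \<epsilon>)"
      by (auto simp: log_plus_def)
    have "real r / \<epsilon> \<ge> 0" "real r * log_plus (2 ^ r / \<epsilon>) \<ge> 0" using \<epsilon> L by auto
    \<comment> \<open>The extra summand \<open>r\<close> pays for the first \<open>r\<close> steps,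
      in which only the doubling bound is used.\<close>
    then have "r \<le> k" using k by linarith
    then obtain j where j: "k = r + j" by (auto simp: le_iff_add)
    have "x r \<le> residual_mean A r (\<lambda>R. Re (mat_trace R))"
      unfolding x_def by (rule residual_mean_mono[OF A]) (rule orth_proj_trace_le[OF P])
    also have "\<dots> \<le> 2 ^ r * b"
      unfolding b_def by (rule residual_mean_trace_doubling[OF A])
    finally have xr: "x r \<le> 2 ^ r * b" .
    show ?thesis
    \<comment> \<open>For \<open>b = 0\<close> the doubling bound already forces \<open>x r\<close>
      down to 0, and monotonicity carries this on to \<open>x k\<close>.\<close>
    proof (cases "b = 0")
      case True
      have "decseq x"
      proof (rule decseq_SucI)
        fix i show "x (Suc i) \<le> x i"
        proof -
          have "0 \<le> (x i)\<^sup>2 / (real r * (x i + b))" using x0[of i] True by simp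
          then show ?thesis using step[of i] by linarith
        qed
      qed
      then have "x k \<le> x r" using \<open>r \<le> k\<close> by (rule decseqD)
      then show ?thesis using xr True by simp
    next
      case False
      then have b: "b > 0" using b0 by simp
      have "2 ^ r * b / (\<epsilon> * b) = 2 ^ r / \<epsilon>" using b by simp
      moreover have "real r * ln (2 ^ r / \<epsilon>) \<le> real r * log_plus (2 ^ r / \<epsilon>)"
        using L(2) by (rule mult_left_mono) simp
      ultimately have "real j \<ge> real r / \<epsilon> + real r * ln (2 ^ r * b / (\<epsilon> * b))"
        using k j by simp
      then have "x (r + j) \<le> \<epsilon> * b"
        \<comment> \<open>Restarted at step \<open>r\<close> with initial bound
          \<open>2 ^ r * b\<close>; the factor \<open>b\<close> cancels in the logarithm, which
          leaves no dependence on the relative error.\<close>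
        using recursion_below_threshold[of "\<lambda>i. x (r + i)" "real r" b \<epsilon> "2 ^ r * b" j] step x0 b r \<epsilon> xr
        by simp
      then show ?thesis unfolding j .
    qed
  qed
  moreover have "measure_pmf.expectation (rp_cholesky A k) (\<lambda>(Ahat, R). Re (mat_trace (A - Ahat)))
      = residual_mean A k (\<lambda>R. Re (mat_trace R))"
    unfolding residual_mean_def using rp_cholesky_support[OF A, of k]
    by (intro integral_cong_AE) (auto simp: AE_measure_pmf_iff)
  \<comment> \<open>The part of the trace outside the range of \<open>P\<close> never exceeds its
    initial value \<open>b\<close>.\<close>
  moreover have "residual_mean A k (\<lambda>R. Re (mat_trace R)) \<le> residual_mean A k (\<lambda>R. b + 1 * Re (mat_trace (P * R)))"
  proof (rule residual_mean_mono[OF A])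
    fix R assume R: "psd_mat N R" and AR: "psd_mat N (A - R)"
    show "Re (mat_trace R) \<le> b + 1 * Re (mat_trace (P * R))"
      using orth_proj_trace_mono[OF orth_proj_compl[OF P] Ac psd_carrier[OF R] AR]
      by (simp add: b_eq trace_split[OF orth_projD(1)[OF P] psd_carrier[OF R]])
  qed
  moreover have "\<dots> = b + x k"
    unfolding residual_mean_affine[OF A] x_def by simp
  ultimately show ?thesis by (simp add: b_def tail_trace_def distrib_right)
qed

end
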